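(* Let $T$ be a complex torus, let $G\subset\mathrm{Aut}_0(T)$ be a finite group and let $\alpha\in H^1(G,T)$ be a special cohomology class. If $M$ is a flat Kähler manifold corresponding to $\alpha$, then the group $\mathrm{Aut}(M)$ of automorphisms of $M$ is an extension of the form $$0\longrightarrow T^G\longrightarrow \mathrm{Aut}(M)\longrightarrow N_\alpha/G\longrightarrow 1.$$
   Context: For a complex torus $T$, $\mathrm{Aut}(T)$ is the group of biholomorphic self-maps of $T$, and $\mathrm{Aut}_0(T)$ is the group of biholomorphic group homomorphisms $T\to T$. There is a short exact sequence $0\to T\to\mathrm{Aut}(T)\xrightarrow{\pi}\mathrm{Aut}_0(T)\to1$, where $T$ acts by translations and $\pi$ takes the linear part. For a finite group $G\subset\mathrm{Aut}_0(T)$, a class $\alpha\in H^1(G,T)$ represented by a 1-cocycle $z\colon G\to T$ (so $z(gh)=z(g)+g\,z(h)$) corresponds to the group $\tilde G=\{x\mapsto gx+z(g) : g\in G\}\subset\mathrm{Aut}(T)$, which $\pi$ maps isomorphically onto $G$. If $T=V/L$ with $V$ a complex vector space and $L$ a lattice, then $H^1(G,T)\cong H^2(G,L)$. The class $\alpha$ is special if the corresponding class in $H^2(G,L)$ defines a torsion-free extension of $G$ by $L$; equivalently, if $\tilde G$ acts freely on $T$. In that case the flat Kähler manifold corresponding to $\alpha$ is $M=T/\tilde G$. $\mathrm{Aut}(M)$ is the group of automorphisms (biholomorphic self-maps) of $M$; equivalently, the group of affine self-equivalences $f$ of the flat manifold $M$ (maps lifting to affine maps of the universal cover) with $df\circ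 J=J\circ df$, where $J$ is the complex structure of $M$. $T^G$ is the group of points of $T$ fixed by $G$. $N_{\mathrm{Aut}_0(T)}(G)$ is the normalizer of $G$ in $\mathrm{Aut}_0(T)$; it acts on $H^1(G,T)$ by the action $*$ induced from the action on 1-cocycles $(n*f)(a)=n\,f(n^{-1}an)$, for $n\in N_{\mathrm{Aut}_0(T)}(G)$, $a\in G$, $f\colon G\to T$ a 1-cocycle. $N_\alpha\subset N_{\mathrm{Aut}_0(T)}(G)$ is the stabilizer of $\alpha$ under this action (it contains $G$). *)

theory Defs
  imports "HOL-Analysis.Analysis" "HOL-Algebra.Algebra"
begin

section \<open>Complex manifolds uniformised by complex n-space\<close>

definition cn_holomorphic_on :: "(complex ^ 'n \<Rightarrow> complex ^ 'm) \<Rightarrow> (complex ^ 'n) set \<Rightarrow> bool"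
  where "cn_holomorphic_on F U \<longleftrightarrow>
    (\<forall>x\<in>U. \<exists>D. (F has_derivative D) (at x) \<and> (\<forall>c v. D (c *s v) = c *s D v))"

text \<open>
  A manifold that is a quotient of complex n-space is given by its projection \<open>p\<close>; its points are
  the elements of \<open>range p\<close>. It carries the quotient topology, and its charts are the inverses of
  the restrictions of \<open>p\<close> to the open sets on which \<open>p\<close> is injective. These cover the manifold,
  and are compatible, whenever \<open>p\<close> is the quotient by a free and properly discontinuous group of
  biholomorphic maps, as in both uses below.
\<close>

definition quot_topology :: "('v::topological_space \<Rightarrow> 'a) \<Rightarrow> 'a topology"
  where "quot_topology p = topology (\<lambda>W. W \<subseteq> range p \<and> open (p -` W))"

lemma openin_quot_topology: "openin (quot_topology p) W \<longleftrightarrow> W \<subseteq> range p \<and> open (p -` W)"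
proof -
  have "istopology (\<lambda>W. W \<subseteq> range p \<and> open (p -` W))"
    unfolding istopology_def by (auto simp: vimage_Union)
  then show ?thesis
    unfolding quot_topology_def by (simp add: topology_inverse')
qed

definition chart_domain :: "('v::topological_space \<Rightarrow> 'a) \<Rightarrow> 'v set \<Rightarrow> bool"
  where "chart_domain p U \<longleftrightarrow> open U \<and> inj_on p U"

definition holomorphic_map ::
    "(complex ^ 'n \<Rightarrow> 'a) \<Rightarrow> (complex ^ 'm \<Rightarrow> 'b) \<Rightarrow> ('a \<Rightarrow> 'b) \<Rightarrow> bool"
  where "holomorphic_map p q f \<longleftrightarrow>
    continuous_map (quot_topology p) (quot_topology q) f \<and>
    (\<forall>U U'. chart_domain p U \<longrightarrow> chart_domain q U' \<longrightarrow>
       cn_holomorphic_on (\<lambda>u. inv_into U' q (f (p u))) {u \<in> U. f (p u) \<in> q ` U'})"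

definition biholomorphic_self_maps :: "(complex ^ 'n \<Rightarrow> 'a) \<Rightarrow> ('a \<Rightarrow> 'a) set"
  where "biholomorphic_self_maps p =
    {f \<in> Bij (range p). holomorphic_map p p f \<and> holomorphic_map p p (inv_into (range p) f)}"

definition Aut :: "(complex ^ 'n \<Rightarrow> 'a) \<Rightarrow> ('a \<Rightarrow> 'a) monoid"
  where "Aut p = (BijGroup (range p))\<lparr>carrier := biholomorphic_self_maps p\<rparr>"


section \<open>Complex tori\<close>

definition is_lattice :: "(complex ^ 'n) set \<Rightarrow> bool"
  where "is_lattice L \<longleftrightarrow>
    (\<exists>B. independent B \<and> span B = UNIV \<and>
         L = {\<Sum>b\<in>B. of_int (k b) *\<^sub>R b | k :: complex ^ 'n \<Rightarrow> int. True})"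

definition vector_group :: "(complex ^ 'n) monoid"
  where "vector_group = \<lparr>carrier = UNIV, mult = (+), one = 0\<rparr>"

text \<open>The group law of the torus is written multiplicatively, as always in HOL-Algebra.\<close>

definition torus :: "(complex ^ 'n) set \<Rightarrow> (complex ^ 'n) set monoid"
  where "torus L = vector_group Mod L"

definition torus_proj :: "(complex ^ 'n) set \<Rightarrow> complex ^ 'n \<Rightarrow> (complex ^ 'n) set"
  where "torus_proj L v = L #>\<^bsub>vector_group\<^esub> v"

lemma carrier_torus: "carrier (torus L) = range (torus_proj L)"
  by (auto simp: torus_def torus_proj_def FactGroup_def RCOSETS_def vector_group_def)

type_synonym 'n torus_map = "(complex ^ 'n) set \<Rightarrow> (complex ^ 'n) set"

definition Aut0 :: "(complex ^ 'n) set \<Rightarrow> 'n torus_map monoid"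
  where "Aut0 L = (Aut (torus_proj L))
    \<lparr>carrier := biholomorphic_self_maps (torus_proj L) \<inter> hom (torus L) (torus L)\<rparr>"


section \<open>First cohomology\<close>

definition cocycles :: "(complex ^ 'n) set \<Rightarrow> 'n torus_map set
    \<Rightarrow> ('n torus_map \<Rightarrow> (complex ^ 'n) set) set"
  where "cocycles L G = {z \<in> G \<rightarrow>\<^sub>E carrier (torus L).
    \<forall>g\<in>G. \<forall>h\<in>G. z (g \<otimes>\<^bsub>Aut0 L\<^esub> h) = z g \<otimes>\<^bsub>torus L\<^esub> g (z h)}"

definition coboundaries :: "(complex ^ 'n) set \<Rightarrow> 'n torus_map set
    \<Rightarrow> ('n torus_map \<Rightarrow> (complex ^ 'n) set) set"
  where "coboundaries L G =
    {\<lambda>g\<in>G. g t \<otimes>\<^bsub>torus L\<^esub> inv\<^bsub>torus L\<^esub> t | t. t \<in> carrier (torus L)}"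

definition cocycle_group :: "(complex ^ 'n) set \<Rightarrow> 'n torus_map set
    \<Rightarrow> ('n torus_map \<Rightarrow> (complex ^ 'n) set) monoid"
  where "cocycle_group L G =
    \<lparr>carrier = cocycles L G,
     mult = (\<lambda>z w. \<lambda>g\<in>G. z g \<otimes>\<^bsub>torus L\<^esub> w g),
     one = (\<lambda>g\<in>G. \<one>\<^bsub>torus L\<^esub>)\<rparr>"

definition H1 :: "(complex ^ 'n) set \<Rightarrow> 'n torus_map set
    \<Rightarrow> ('n torus_map \<Rightarrow> (complex ^ 'n) set) set monoid"
  where "H1 L G = cocycle_group L G Mod coboundaries L G"


section \<open>Special classes\<close>

definition linear_lift :: "(complex ^ 'n) set \<Rightarrow> 'n torus_map \<Rightarrow> complex ^ 'n \<Rightarrow> complex ^ 'n"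
  where "linear_lift L g = (THE A. Vector_Spaces.linear (*s) (*s) A \<and>
    (\<forall>v. g (torus_proj L v) = torus_proj L (A v)))"

text \<open>
  The isomorphism from \<open>H\<^sup>1(G,T)\<close> to \<open>H\<^sup>2(G,L)\<close> is the connecting homomorphism of
  \<open>0 \<rightarrow> L \<rightarrow> V \<rightarrow> T \<rightarrow> 0\<close>: lift a 1-cocycle to a cochain \<open>s\<close> with values in \<open>V\<close> and take the
  coboundary of \<open>s\<close>, which has values in \<open>L\<close>.
\<close>

definition connecting :: "(complex ^ 'n) set \<Rightarrow> ('n torus_map \<Rightarrow> complex ^ 'n)
    \<Rightarrow> 'n torus_map \<Rightarrow> 'n torus_map \<Rightarrow> complex ^ 'n"
  where "connecting L s g h = s g + linear_lift L g (s h) - s (g \<otimes>\<^bsub>Aut0 L\<^esub> h)"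

text \<open>The 2-cocycle \<open>c\<close> is not assumed to be normalised, whence the form of the neutral element.\<close>

definition extension_group :: "(complex ^ 'n) set \<Rightarrow> 'n torus_map set
    \<Rightarrow> ('n torus_map \<Rightarrow> 'n torus_map \<Rightarrow> complex ^ 'n) \<Rightarrow> ((complex ^ 'n) \<times> 'n torus_map) monoid"
  where "extension_group L G c =
    \<lparr>carrier = L \<times> G,
     mult = (\<lambda>(l, g) (m, h). (l + linear_lift L g m + c g h, g \<otimes>\<^bsub>Aut0 L\<^esub> h)),
     one = (- c \<one>\<^bsub>Aut0 L\<^esub> \<one>\<^bsub>Aut0 L\<^esub>, \<one>\<^bsub>Aut0 L\<^esub>)\<rparr>"

definition torsion_free :: "('a, 'b) monoid_scheme \<Rightarrow> bool"
  where "torsion_free E \<longleftrightarrow>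
    (\<forall>x\<in>carrier E. \<forall>n::nat. n > 0 \<longrightarrow> x [^]\<^bsub>E\<^esub> n = \<one>\<^bsub>E\<^esub> \<longrightarrow> x = \<one>\<^bsub>E\<^esub>)"

text \<open>
  Different choices of \<open>z\<close> and \<open>s\<close> give cohomologous 2-cocycles, hence isomorphic extensions.
\<close>

definition special :: "(complex ^ 'n) set \<Rightarrow> 'n torus_map set
    \<Rightarrow> ('n torus_map \<Rightarrow> (complex ^ 'n) set) set \<Rightarrow> bool"
  where "special L G \<alpha> \<longleftrightarrow>
    (\<forall>z\<in>\<alpha>. \<forall>s. (\<forall>g\<in>G. torus_proj L (s g) = z g) \<longrightarrow>
       torsion_free (extension_group L G (connecting L s)))"


section \<open>The flat manifold of a special class\<close>

definition affine_group :: "(complex ^ 'n) set \<Rightarrow> 'n torus_map set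
    \<Rightarrow> ('n torus_map \<Rightarrow> (complex ^ 'n) set) \<Rightarrow> 'n torus_map monoid"
  where "affine_group L G z = (Aut (torus_proj L))
    \<lparr>carrier := {\<lambda>x\<in>carrier (torus L). g x \<otimes>\<^bsub>torus L\<^esub> z g | g. g \<in> G}\<rparr>"

definition flat_manifold :: "(complex ^ 'n) set \<Rightarrow> 'n torus_map set
    \<Rightarrow> ('n torus_map \<Rightarrow> (complex ^ 'n) set) \<Rightarrow> (complex ^ 'n) set set set"
  where "flat_manifold L G z = orbits (affine_group L G z) (carrier (torus L)) (\<lambda>\<phi>. \<phi>)"

definition flat_proj :: "(complex ^ 'n) set \<Rightarrow> 'n torus_map set
    \<Rightarrow> ('n torus_map \<Rightarrow> (complex ^ 'n) set) \<Rightarrow> complex ^ 'n \<Rightarrow> (complex ^ 'n) set set"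
  where "flat_proj L G z v = orbit (affine_group L G z) (\<lambda>\<phi>. \<phi>) (torus_proj L v)"

lemma flat_manifold_eq: "flat_manifold L G z = range (flat_proj L G z)"
  by (auto simp: flat_manifold_def flat_proj_def orbits_def carrier_torus)


section \<open>Fixed points, stabilisers and extensions\<close>

definition fixed_points :: "(complex ^ 'n) set \<Rightarrow> 'n torus_map set \<Rightarrow> (complex ^ 'n) set monoid"
  where "fixed_points L G = (torus L)\<lparr>carrier := {x \<in> carrier (torus L). \<forall>g\<in>G. g x = x}\<rparr>"

definition cocycle_action :: "(complex ^ 'n) set \<Rightarrow> 'n torus_map set \<Rightarrow> 'n torus_map
    \<Rightarrow> ('n torus_map \<Rightarrow> (complex ^ 'n) set) \<Rightarrow> 'n torus_map \<Rightarrow> (complex ^ 'n) set"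
  where "cocycle_action L G n f =
    (\<lambda>a\<in>G. n (f (inv\<^bsub>Aut0 L\<^esub> n \<otimes>\<^bsub>Aut0 L\<^esub> a \<otimes>\<^bsub>Aut0 L\<^esub> n)))"

definition class_stabilizer :: "(complex ^ 'n) set \<Rightarrow> 'n torus_map set
    \<Rightarrow> ('n torus_map \<Rightarrow> (complex ^ 'n) set) set \<Rightarrow> 'n torus_map monoid"
  where "class_stabilizer L G \<alpha> = (Aut0 L)
    \<lparr>carrier := stabilizer ((Aut0 L)\<lparr>carrier := normalizer (Aut0 L) G\<rparr>)
                  (\<lambda>n. image (cocycle_action L G n)) \<alpha>\<rparr>"

text \<open>
  \<open>B\<close> is an extension of \<open>C\<close> by \<open>A\<close>. The library's \<open>short_exact_sequence\<close> needs all groups to have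
  elements of the same type.
\<close>

definition is_extension :: "'a monoid \<Rightarrow> 'b monoid \<Rightarrow> 'c monoid \<Rightarrow> bool"
  where "is_extension A B C \<longleftrightarrow>
    Group.group A \<and> Group.group B \<and> Group.group C \<and>
    (\<exists>i q. i \<in> mon A B \<and> q \<in> epi B C \<and> i ` carrier A = kernel B C q)"

end

theory Submission
  imports Defs "HOL-Complex_Analysis.Cauchy_Integral_Formula"
begin

text \<open>
  Let \<open>V\<close> be complex \<open>n\<close>-space, \<open>T = V / L\<close> and \<open>M\<close> the quotient of \<open>T\<close> by the maps
  \<open>x \<mapsto> g x + z g\<close>. Lift \<open>z\<close> to a function \<open>s\<close> with values in \<open>V\<close>. Then \<open>M\<close> is the quotient of \<open>V\<close> by the group
  \<open>\<Gamma>\<close> of the affine maps \<open>v \<mapsto> g v + s g + l\<close> with \<open>g\<close> in \<open>G\<close> and \<open>l\<close> in \<open>L\<close>, which is the extension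
  of \<open>G\<close> by \<open>L\<close> that the class defines. An element of \<open>\<Gamma>\<close> with a fixed point has a power that is a translation
  with a fixed point, so it is a torsion element. As the class is special, \<open>\<Gamma>\<close> acts freely
  (\<open>deck_free\<close>), and properly discontinuously because \<open>G\<close> is finite and \<open>L\<close> is discrete
  (\<open>deck_wandering\<close>).

  The analytic part is that every biholomorphic self-map \<open>f\<close> of \<open>M\<close> is induced by a complex affine
  map of \<open>V\<close> (\<open>biholomorphic_lift\<close>). By covering theory \<open>f\<close> lifts to an entire map \<open>F\<close>
  (\<open>lift_exists\<close>), and \<open>F (\<gamma> v) = \<gamma>' (F v)\<close> for a suitable \<open>\<gamma>'\<close> in \<open>\<Gamma>\<close>, for each \<open>\<gamma>\<close> in \<open>\<Gamma>\<close>
  (\<open>lift_unique\<close>). For \<open>\<gamma>\<close> a translation by an element of \<open>L\<close>, the \<open>card G\<close>-th power of \<open>\<gamma>'\<close> is a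
  translation too. So \<open>F\<close> commutes up to constants with the translations by the lattice \<open>card G * L\<close>;
  it therefore grows at most linearly, and Liouville's theorem makes it affine
  (\<open>entire_translation_equivariant_affine\<close>). With \<open>G\<close> trivial this also
  shows that the elements of \<open>Aut0 L\<close> are induced by linear maps.

  The rest is algebra. \<open>Aut M\<close> is the group of affine maps \<open>F v = n v + b\<close> that normalise \<open>\<Gamma>\<close>,
  modulo \<open>\<Gamma>\<close>. Comparing linear and translation parts, \<open>F\<close> normalises \<open>\<Gamma>\<close> if and only if \<open>n\<close>
  normalises \<open>G\<close> and \<open>n * z\<close> is \<open>z\<close> plus the coboundary of the point \<open>b\<close> of the torus
  (\<open>affine_lifts_iff\<close>, \<open>cocycle_action_eq_iff\<close>). Hence a linear part \<open>n\<close> occurs if and only if it fixes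
  the class of \<open>z\<close> (\<open>carrier_stabilizer\<close>). Taking linear parts maps \<open>\<Gamma>\<close> onto \<open>G\<close>, so it
  induces a surjection from \<open>Aut M\<close> to the stabiliser modulo \<open>G\<close>. A map in its kernel has a lift with trivial
  linear part, a translation, and the translation by \<open>b\<close> normalises \<open>\<Gamma>\<close> exactly if the coboundary of \<open>b\<close>
  vanishes, that is, if \<open>b\<close> represents a fixed point of \<open>G\<close>.
\<close>

section \<open>Quotients by free wandering actions\<close>

text \<open>
  The fibres of \<open>p\<close> are the orbits of \<open>\<Gamma>\<close>. The wandering neighbourhoods say in one condition that the
  action is free and properly discontinuous, so that \<open>p\<close> is a covering of the quotient. The quotient
  is a bare type whose topology is only implicit in \<open>p\<close>; a subset of it counts as
  open if its preimage under \<open>p\<close> is open.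
\<close>

locale free_quotient =
  fixes \<Gamma> :: "('v::real_normed_vector \<Rightarrow> 'v) set" and p :: "'v \<Rightarrow> 'a"
  assumes id_mem: "id \<in> \<Gamma>"
    and comp_mem: "\<gamma> \<in> \<Gamma> \<Longrightarrow> \<delta> \<in> \<Gamma> \<Longrightarrow> \<gamma> \<circ> \<delta> \<in> \<Gamma>"
    and left_inverse: "\<gamma> \<in> \<Gamma> \<Longrightarrow> \<exists>\<delta>\<in>\<Gamma>. \<delta> \<circ> \<gamma> = id"
    and continuous: "\<gamma> \<in> \<Gamma> \<Longrightarrow> continuous_on UNIV \<gamma>"
    and wandering: "\<exists>W. open W \<and> w \<in> W \<and> (\<forall>\<gamma>\<in>\<Gamma>. \<gamma> ` W \<inter> W \<noteq> {} \<longrightarrow> \<gamma> = id)"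
    and fibre: "p v = p w \<longleftrightarrow> (\<exists>\<gamma>\<in>\<Gamma>. w = \<gamma> v)"
begin

lemma inverse_mem:
  assumes "\<gamma> \<in> \<Gamma>"
  obtains \<delta> where "\<delta> \<in> \<Gamma>" "\<delta> \<circ> \<gamma> = id" "\<gamma> \<circ> \<delta> = id"
proof -
  obtain \<delta> where \<delta>: "\<delta> \<in> \<Gamma>" "\<delta> \<circ> \<gamma> = id" using left_inverse assms by blast
  obtain \<epsilon> where \<epsilon>: "\<epsilon> \<in> \<Gamma>" "\<epsilon> \<circ> \<delta> = id" using left_inverse \<delta> by blast
  have "\<epsilon> = \<gamma>" by (metis \<delta>(2) \<epsilon>(2) comp_assoc comp_id fun.map_id id_comp)
  then show ?thesis using that \<delta> \<epsilon> by blast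
qed

lemma p_deck: "\<gamma> \<in> \<Gamma> \<Longrightarrow> p (\<gamma> v) = p v"
  using fibre by metis

lemma bij_deck: "\<gamma> \<in> \<Gamma> \<Longrightarrow> bij \<gamma>"
  by (metis inverse_mem o_bij)

lemma open_image_deck:
  assumes "\<gamma> \<in> \<Gamma>" "open U"
  shows "open (\<gamma> ` U)"
proof -
  obtain \<delta> where \<delta>: "\<delta> \<in> \<Gamma>" "\<delta> \<circ> \<gamma> = id" "\<gamma> \<circ> \<delta> = id" using inverse_mem assms by blast
  then have "\<gamma> ` U = \<delta> -` U"
    by (auto simp: image_iff fun_eq_iff) (metis)+
  then show ?thesis
    using continuous[OF \<delta>(1)] assms(2) by (metis continuous_on_open_vimage open_UNIV Int_UNIV_right)
qed

lemma saturation: "p -` (p ` U) = (\<Union>\<gamma>\<in>\<Gamma>. \<gamma> ` U)"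
  by (auto simp: image_iff) (metis fibre, metis fibre)

lemma open_saturation: "open U \<Longrightarrow> open (p -` (p ` U))"
  unfolding saturation by (intro open_UN ballI open_image_deck)

lemma wandering_inj_on:
  assumes "\<forall>\<gamma>\<in>\<Gamma>. \<gamma> ` W \<inter> W \<noteq> {} \<longrightarrow> \<gamma> = id"
  shows "inj_on p W"
proof (rule inj_onI)
  fix x y assume xy: "x \<in> W" "y \<in> W" "p x = p y"
  then obtain \<gamma> where "\<gamma> \<in> \<Gamma>" "y = \<gamma> x" using fibre by blast
  then have "\<gamma> ` W \<inter> W \<noteq> {}" using xy by blast
  then have "\<gamma> = id" using assms \<open>\<gamma> \<in> \<Gamma>\<close> by blast
  then show "x = y" using \<open>y = \<gamma> x\<close> by simp
qed

lemma chart_at: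
  obtains W where "chart_domain p W" "w \<in> W"
  using wandering[of w] wandering_inj_on chart_domain_def by metis

text \<open>
  A continuous map \<open>h\<close> from a vector space to the quotient lifts through \<open>p\<close>. The quotient has no
  topology as a type, so the covering \<open>p\<close> is replaced by its pullback along \<open>h\<close>: the set
  \<open>{(u, w). h u = p w}\<close> lies in a normed space, its first projection is a covering of a simply
  connected space, and a lift of the identity through that projection has the required lift of \<open>h\<close> as
  its second component. The hypothesis \<open>h_open\<close> is continuity of \<open>h\<close>, as the sets
  \<open>p ` U\<close> are the open sets of the quotient.
\<close>

lemma lift_exists:
  fixes h :: "'u::real_normed_vector \<Rightarrow> 'a"
  assumes h_open: "\<And>U. open U \<Longrightarrow> open (h -` (p ` U))" and h_range: "range h \<subseteq> range p"
  obtains F where "continuous_on UNIV F" "\<And>u. p (F u) = h u"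
proof -
  define E where "E = {(u, w). h u = p w}"
  have cov: "covering_space E fst UNIV"
    unfolding covering_space_def
  proof (intro conjI ballI)
    show "continuous_on E fst" by (intro continuous_intros)
    have "u \<in> fst ` E" for u
    proof -
      obtain w where "h u = p w" using h_range by blast
      then have "(u, w) \<in> E" by (simp add: E_def)
      then show ?thesis by force
    qed
    then show "fst ` E = UNIV" by blast
  next
    fix u0 :: 'u
    obtain w0 where w0: "h u0 = p w0" using h_range by blast
    obtain W where W: "open W" "w0 \<in> W" "\<forall>\<gamma>\<in>\<Gamma>. \<gamma> ` W \<inter> W \<noteq> {} \<longrightarrow> \<gamma> = id"
      using wandering by blast
    define T where "T = h -` (p ` W)"
    have inj: "inj_on p W" using wandering_inj_on W(3) .
    define s where "s u = inv_into W p (h u)" for u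
    have s: "s u \<in> W" "p (s u) = h u" if "u \<in> T" for u
      using that unfolding T_def s_def by (auto intro: inv_into_into f_inv_into_f)
    have "open T" unfolding T_def by (rule h_open[OF W(1)])
    have cont_s: "continuous_on T s"
      unfolding continuous_on_open_vimage[OF \<open>open T\<close>]
    proof (intro allI impI)
      fix B assume "open (B :: 'v set)"
      have "s -` B \<inter> T = h -` (p ` (W \<inter> B))"
      proof
        show "s -` B \<inter> T \<subseteq> h -` (p ` (W \<inter> B))"
          using s by (force simp: image_iff)
        show "h -` (p ` (W \<inter> B)) \<subseteq> s -` B \<inter> T"
          using inj by (auto simp: T_def s_def)
      qed
      then show "open (s -` B \<inter> T)" using h_open[OF open_Int[OF W(1) \<open>open B\<close>]] by (simp only:)
    qed
    \<comment> \<open>The sheets over \<open>T\<close> are indexed by the translates of \<open>W\<close>.\<close>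
    define piece where "piece \<gamma> = E \<inter> (UNIV \<times> \<gamma> ` W)" for \<gamma>
    have piece_fst: "u \<in> T" if "(u, w) \<in> piece \<gamma>" "\<gamma> \<in> \<Gamma>" for u w \<gamma>
      using that p_deck unfolding piece_def E_def T_def by auto
    show "\<exists>T. u0 \<in> T \<and> openin (top_of_set UNIV) T \<and>
       (\<exists>v. \<Union> v = E \<inter> fst -` T \<and> (\<forall>u\<in>v. openin (top_of_set E) u) \<and>
            pairwise disjnt v \<and> (\<forall>u\<in>v. \<exists>q. homeomorphism u T fst q))"
    proof (rule exI[of _ T], intro conjI exI[of _ "piece ` \<Gamma>"])
      show "u0 \<in> T" using w0 W(2) by (simp add: T_def)
      show "openin (top_of_set UNIV) T" using \<open>open T\<close> by simp
      show "\<Union> (piece ` \<Gamma>) = E \<inter> fst -` T"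
      proof
        show "\<Union> (piece ` \<Gamma>) \<subseteq> E \<inter> fst -` T"
          using piece_fst by (fastforce simp: piece_def)
        show "E \<inter> fst -` T \<subseteq> \<Union> (piece ` \<Gamma>)"
        proof clarsimp
          fix u w assume uw: "(u, w) \<in> E" "u \<in> T"
          then have "p (s u) = p w" using s by (simp add: E_def)
          then obtain \<gamma> where "\<gamma> \<in> \<Gamma>" "w = \<gamma> (s u)" using fibre by blast
          then show "\<exists>\<gamma>\<in>\<Gamma>. (u, w) \<in> piece \<gamma>" using uw s by (auto simp: piece_def)
        qed
      qed
      show "\<forall>u\<in>piece ` \<Gamma>. openin (top_of_set E) u"
        unfolding piece_def using W(1) open_image_deck
        by (auto intro!: openin_open_Int open_Times)
      show "pairwise disjnt (piece ` \<Gamma>)"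
      proof (rule pairwiseI)
        fix a b assume "a \<in> piece ` \<Gamma>" "b \<in> piece ` \<Gamma>" "a \<noteq> b"
        then obtain \<gamma> \<delta> where gd: "\<gamma> \<in> \<Gamma>" "\<delta> \<in> \<Gamma>" "a = piece \<gamma>" "b = piece \<delta>" "\<gamma> \<noteq> \<delta>" by blast
        obtain \<delta>' where d': "\<delta>' \<in> \<Gamma>" "\<delta>' \<circ> \<delta> = id" "\<delta> \<circ> \<delta>' = id" using inverse_mem gd by blast
        have "\<gamma> ` W \<inter> \<delta> ` W = {}"
        proof (rule ccontr)
          assume "\<gamma> ` W \<inter> \<delta> ` W \<noteq> {}"
          then obtain x y where xy: "x \<in> W" "y \<in> W" "\<gamma> x = \<delta> y" by blast
          then have "(\<delta>' \<circ> \<gamma>) x = y" using d' by (metis comp_apply id_apply)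
          then have "\<delta>' \<circ> \<gamma> = id" using W(3) comp_mem[OF d'(1) gd(1)] xy by blast
          then have "\<gamma> = \<delta>" by (metis d'(3) comp_assoc comp_id id_comp)
          then show False using gd by simp
        qed
        then show "disjnt a b" by (auto simp: gd piece_def disjnt_def)
      qed
      show "\<forall>u\<in>piece ` \<Gamma>. \<exists>q. homeomorphism u T fst q"
      proof clarify
        fix \<gamma> assume g: "\<gamma> \<in> \<Gamma>"
        have "homeomorphism (piece \<gamma>) T fst (\<lambda>u. (u, \<gamma> (s u)))"
          unfolding homeomorphism_def
        proof (intro conjI ballI)
          have mem: "(u, \<gamma> (s u)) \<in> piece \<gamma>" if "u \<in> T" for u
            using s[OF that] p_deck[OF g] by (auto simp: piece_def E_def)
          have eq: "(fst x, \<gamma> (s (fst x))) = x" if xp: "x \<in> piece \<gamma>" for x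
          proof -
            obtain u w where x: "x = (u, \<gamma> w)" "w \<in> W" "h u = p (\<gamma> w)"
              using xp by (auto simp: piece_def E_def)
            then have "u \<in> T" using piece_fst xp g by blast
            then have "s u = w" using s[of u] x inj p_deck[OF g] by (metis inj_onD)
            then show ?thesis using x by simp
          qed
          show "fst ` piece \<gamma> = T" using piece_fst g mem by force
          show "(\<lambda>u. (u, \<gamma> (s u))) ` T = piece \<gamma>"
            using piece_fst g mem eq by (auto simp: image_iff)
          show "(fst x, \<gamma> (s (fst x))) = x" if "x \<in> piece \<gamma>" for x using eq that .
          show "continuous_on (piece \<gamma>) fst" by (intro continuous_intros)
          show "continuous_on T (\<lambda>u. (u, \<gamma> (s u)))"
            by (intro continuous_intros continuous_on_compose2[OF continuous[OF g] cont_s]) auto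
        qed auto
        then show "\<exists>q. homeomorphism (piece \<gamma>) T fst q" by blast
      qed
    qed
  qed
  obtain g where g: "continuous_on UNIV g" "g \<in> UNIV \<rightarrow> E" "\<And>u. u \<in> UNIV \<Longrightarrow> fst (g u) = id u"
    by (rule covering_space_lift[OF cov, of UNIV id])
       (auto intro: convex_imp_simply_connected convex_imp_locally_path_connected)
  have "p (snd (g u)) = h u" for u
    using g(2) g(3)[of u] by (auto simp: E_def Pi_iff split_beta) metis
  moreover have "continuous_on UNIV (\<lambda>u. snd (g u))"
    using g(1) by (intro continuous_intros)
  ultimately show ?thesis using that[of "\<lambda>u. snd (g u)"] by blast
qed

text \<open>
  The lift of one and the same map is unique up to \<open>\<Gamma>\<close>: the set where \<open>H\<close> agrees with \<open>\<gamma> \<circ> F\<close> is closed,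
  and it is open because \<open>p\<close> is injective on wandering neighbourhoods. This one lemma yields
  equivariance of lifts, their invertibility and the kernel of the descent to the quotient.
\<close>

lemma lift_unique:
  fixes F H :: "'u::real_normed_vector \<Rightarrow> 'v"
  assumes F: "continuous_on UNIV F" and H: "continuous_on UNIV H" and eq: "\<And>u. p (F u) = p (H u)"
  obtains \<gamma> where "\<gamma> \<in> \<Gamma>" "H = \<gamma> \<circ> F"
proof -
  obtain \<gamma> where g: "\<gamma> \<in> \<Gamma>" "H 0 = \<gamma> (F 0)" using fibre eq by blast
  have cont: "continuous_on UNIV (\<gamma> \<circ> F)"
    using continuous[OF g(1)] F by (metis continuous_on_compose continuous_on_subset subset_UNIV)
  let ?D = "{u. H u = (\<gamma> \<circ> F) u}"
  have "closed ?D" using closed_Collect_eq[OF H cont] .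
  moreover have "open ?D"
  proof (subst open_subopen, clarify)
    fix u assume u: "H u = (\<gamma> \<circ> F) u"
    obtain W where W: "open W" "H u \<in> W" "\<forall>\<gamma>\<in>\<Gamma>. \<gamma> ` W \<inter> W \<noteq> {} \<longrightarrow> \<gamma> = id"
      using wandering by blast
    have inj: "inj_on p W" using wandering_inj_on W(3) .
    let ?T = "H -` W \<inter> (\<gamma> \<circ> F) -` W"
    have "open ?T" using H cont W(1)
      by (intro open_Int) (metis continuous_on_open_vimage open_UNIV Int_UNIV_right)+
    moreover have "u \<in> ?T" using W(2) u by simp
    moreover have "?T \<subseteq> ?D"
    proof
      fix x assume x: "x \<in> ?T"
      have "p (H x) = p ((\<gamma> \<circ> F) x)" using eq[of x] p_deck[OF g(1)] by simp
      then show "x \<in> ?D" using inj x by (auto dest: inj_onD)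
    qed
    ultimately show "\<exists>T. open T \<and> u \<in> T \<and> T \<subseteq> ?D" by blast
  qed
  ultimately have "?D = UNIV" using clopen[of ?D] g(2) by auto
  then show ?thesis using that g(1) by fastforce
qed

end

section \<open>Lattices\<close>

lemma lattice_basis:
  fixes L :: "(complex ^ 'n) set"
  assumes "is_lattice L"
  obtains B where "finite B" "independent B" "span B = UNIV"
    "L = {\<Sum>b\<in>B. of_int (k b) *\<^sub>R b | k :: complex ^ 'n \<Rightarrow> int. True}"
proof -
  obtain B where B: "independent B" "span B = UNIV"
    "L = {\<Sum>b\<in>B. of_int (k b) *\<^sub>R b | k :: complex ^ 'n \<Rightarrow> int. True}"
    using assms unfolding is_lattice_def by blast
  show thesis by (rule that[OF _ B]) (rule independent_imp_finite[OF B(1)])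
qed

lemma lattice_zero: "is_lattice L \<Longrightarrow> 0 \<in> L"
  by (erule lattice_basis) (auto intro!: exI[of _ "\<lambda>_. 0"])

lemma lattice_add:
  assumes "is_lattice L" "l \<in> L" "m \<in> L" shows "l + m \<in> L"
proof -
  obtain B where B: "L = {\<Sum>b\<in>B. of_int (k b) *\<^sub>R b | k. True}" using assms(1) by (rule lattice_basis)
  obtain k k' where "l = (\<Sum>b\<in>B. of_int (k b) *\<^sub>R b)" "m = (\<Sum>b\<in>B. of_int (k' b) *\<^sub>R b)"
    using assms B by blast
  then have eq: "l + m = (\<Sum>b\<in>B. of_int (k b + k' b) *\<^sub>R b)"
    by (simp add: sum.distrib scaleR_left_distrib)
  show ?thesis unfolding B by (rule CollectI, rule exI[of _ "\<lambda>b. k b + k' b"]) (simp only: eq simp_thms)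
qed

lemma lattice_uminus:
  assumes "is_lattice L" "l \<in> L" shows "- l \<in> L"
proof -
  obtain B where B: "L = {\<Sum>b\<in>B. of_int (k b) *\<^sub>R b | k. True}" using assms(1) by (rule lattice_basis)
  obtain k where "l = (\<Sum>b\<in>B. of_int (k b) *\<^sub>R b)" using assms B by blast
  then have eq: "- l = (\<Sum>b\<in>B. of_int (- k b) *\<^sub>R b)" by (simp add: sum_negf)
  show ?thesis unfolding B by (rule CollectI, rule exI[of _ "\<lambda>b. - k b"]) (simp only: eq simp_thms)
qed

lemma lattice_diff: "is_lattice L \<Longrightarrow> l \<in> L \<Longrightarrow> m \<in> L \<Longrightarrow> l - m \<in> L"
  using lattice_add[of L l "- m"] lattice_uminus[of L m] by simp

text \<open>
  The coordinates with respect to the lattice basis are continuous linear functionals, so a short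
  lattice vector has integer coordinates of absolute value less than one.
\<close>

lemma lattice_discrete:
  fixes L :: "(complex ^ 'n) set"
  assumes "is_lattice L"
  obtains e where "e > 0" "\<And>l. l \<in> L \<Longrightarrow> norm l < e \<Longrightarrow> l = 0"
proof -
  obtain B where B: "finite B" "independent B" "span B = UNIV"
    "L = {\<Sum>b\<in>B. of_int (k b) *\<^sub>R b | k :: complex ^ 'n \<Rightarrow> int. True}"
    using assms by (rule lattice_basis)
  have "\<exists>c>0. \<forall>v. norm (representation B v b) \<le> norm v * c" for b
  proof -
    have "linear (\<lambda>v. representation B v b)"
      using B by (intro linearI) (auto simp: real_vector.representation_add real_vector.representation_scale)
    then have "bounded_linear (\<lambda>v. representation B v b)"
      using linear_conv_bounded_linear by blast
    then show ?thesis using bounded_linear.pos_bounded by blast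
  qed
  then obtain c where c: "\<And>b. c b > 0" "\<And>b v. norm (representation B v b) \<le> norm v * c b"
    by metis
  define C where "C = 1 + (\<Sum>b\<in>B. c b)"
  have "(\<Sum>b\<in>B. c b) \<ge> 0" using c(1) by (simp add: sum_nonneg less_imp_le)
  then have "C > 0" by (simp add: C_def)
  have "c b \<le> C" if "b \<in> B" for b
    using member_le_sum[OF that, of c] c(1) B(1) by (simp add: C_def less_imp_le add.commute add_increasing2)
  note C = \<open>C > 0\<close> this
  show ?thesis
  proof (rule that[of "1 / C"])
    show "1 / C > 0" using C by simp
    fix l assume l: "l \<in> L" "norm l < 1 / C"
    obtain k where k: "l = (\<Sum>b\<in>B. of_int (k b) *\<^sub>R b)" using l B by blast
    have "of_int (k b) = representation B l b" if "b \<in> B" for b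
    proof -
      have "representation B l b = (\<Sum>b'\<in>B. of_int (k b') * representation B b' b)"
        unfolding k using B
        by (simp add: real_vector.representation_sum real_vector.representation_scale)
      also have "\<dots> = (\<Sum>b'\<in>B. if b' = b then of_int (k b') else 0)"
        using B by (intro sum.cong) (auto simp: real_vector.representation_basis)
      finally show ?thesis using that B(1) by simp
    qed
    moreover have "norm (representation B l b) < 1" if "b \<in> B" for b
    proof -
      have "norm (representation B l b) \<le> norm l * C"
        using c(2)[of l b] C(2)[OF that] by (meson mult_left_mono norm_ge_zero order_trans)
      also have "\<dots> < 1" using l C by (simp add: field_simps)
      finally show ?thesis .
    qed
    ultimately have "\<bar>of_int (k b) :: real\<bar> < 1" if "b \<in> B" for b using that by force
    then have "k b = 0" if "b \<in> B" for b using that by fastforce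
    then show "l = 0" unfolding k by simp
  qed
qed

text \<open>
  Rounding the coordinates down leaves a remainder in the fundamental parallelotope, whose vectors are
  no longer than the sum of the lengths of its edges.
\<close>

lemma lattice_cocompact:
  fixes L :: "(complex ^ 'n) set"
  assumes "is_lattice L"
  obtains R where "\<And>v. \<exists>l\<in>L. norm (v - l) \<le> R"
proof -
  obtain B where B: "finite B" "independent B" "span B = UNIV"
    "L = {\<Sum>b\<in>B. of_int (k b) *\<^sub>R b | k :: complex ^ 'n \<Rightarrow> int. True}"
    using assms by (rule lattice_basis)
  have "\<exists>l\<in>L. norm (v - l) \<le> (\<Sum>b\<in>B. norm b)" for v
  proof -
    let ?r = "representation B v"
    let ?l = "\<Sum>b\<in>B. of_int \<lfloor>?r b\<rfloor> *\<^sub>R b"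
    have "(\<Sum>b\<in>B. ?r b *\<^sub>R b) = v"
      by (rule real_vector.sum_representation_eq) (use B in auto)
    moreover have "(\<Sum>b\<in>B. ?r b *\<^sub>R b) - ?l = (\<Sum>b\<in>B. frac (?r b) *\<^sub>R b)"
      by (simp add: sum_subtractf scaleR_diff_left frac_def)
    ultimately have "v - ?l = (\<Sum>b\<in>B. frac (?r b) *\<^sub>R b)" by simp
    also have "norm \<dots> \<le> (\<Sum>b\<in>B. norm b)"
    proof (rule sum_norm_le)
      show "norm (frac (?r b) *\<^sub>R b) \<le> norm b" for b
        by (simp add: mult_left_le_one_le frac_lt_1 less_imp_le)
    qed
    finally have "norm (v - ?l) \<le> (\<Sum>b\<in>B. norm b)" .
    moreover have "?l \<in> L" unfolding B(4) by (rule CollectI, rule exI[of _ "\<lambda>b. \<lfloor>?r b\<rfloor>"]) simp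
    ultimately show ?thesis by blast
  qed
  then show ?thesis using that by blast
qed

section \<open>Complex affine maps\<close>

abbreviation clinear :: "(complex ^ 'n \<Rightarrow> complex ^ 'm) \<Rightarrow> bool"
  where "clinear A \<equiv> Vector_Spaces.linear (*s) (*s) A"

lemma clinear_iff: "clinear A \<longleftrightarrow> (\<forall>v w. A (v + w) = A v + A w) \<and> (\<forall>c v. A (c *s v) = c *s A v)"
  by (simp add: Vector_Spaces.linear_iff vec.vector_space_axioms)

lemma clinear_add: "clinear A \<Longrightarrow> A (v + w) = A v + A w"
  and clinear_scale: "clinear A \<Longrightarrow> A (c *s v) = c *s A v"
  by (simp_all add: clinear_iff)

lemma clinear_zero: "clinear A \<Longrightarrow> A 0 = 0"
  using clinear_scale[of A 0 0] by simp

lemma clinear_uminus: "clinear A \<Longrightarrow> A (- v) = - A v"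
  using clinear_scale[of A "- 1" v] by simp

lemma clinear_diff: "clinear A \<Longrightarrow> A (v - w) = A v - A w"
  using clinear_add[of A v "- w"] by (simp add: clinear_uminus)

lemma scaleR_eq_scale: "r *\<^sub>R v = complex_of_real r *s (v :: complex ^ 'n)"
  by (simp add: vec_eq_iff scaleR_conv_of_real[where 'a = complex])

lemma clinear_bounded_linear: "clinear A \<Longrightarrow> bounded_linear A"
  unfolding linear_conv_bounded_linear[symmetric]
  by (intro linearI) (auto simp: clinear_add clinear_scale scaleR_eq_scale)

text \<open>
  Subtracting the value at the origin makes the linear part of an affine map explicit, so no
  existential quantifier over linear parts is needed.
\<close>

definition complex_affine :: "(complex ^ 'n \<Rightarrow> complex ^ 'n) \<Rightarrow> bool"
  where "complex_affine F \<longleftrightarrow> clinear (\<lambda>v. F v - F 0)"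

definition linear_part :: "(complex ^ 'n \<Rightarrow> complex ^ 'n) \<Rightarrow> complex ^ 'n \<Rightarrow> complex ^ 'n"
  where "linear_part F v = F v - F 0"

lemma clinear_linear_part: "complex_affine F \<Longrightarrow> clinear (linear_part F)"
  unfolding complex_affine_def linear_part_def[abs_def] .

lemma affine_eq: "F v = linear_part F v + F 0"
  by (simp add: linear_part_def)

lemma
  assumes "clinear A"
  shows complex_affineI: "complex_affine (\<lambda>v. A v + b)"
    and linear_part_affine: "linear_part (\<lambda>v. A v + b) = A"
  using assms by (auto simp: complex_affine_def linear_part_def clinear_zero)

lemma clinear_id: "clinear (\<lambda>v. v)"
  by (simp add: clinear_iff)

lemma clinear_comp: "clinear A \<Longrightarrow> clinear A' \<Longrightarrow> clinear (A \<circ> A')"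
  by (simp add: clinear_iff)

lemma clinear_inv:
  assumes "clinear A" "bij A" shows "clinear (inv_into UNIV A)"
proof -
  have A: "A (inv_into UNIV A v) = v" for v using assms(2) by (simp add: bij_is_surj surj_f_inv_f)
  have inj: "x = y" if "A x = A y" for x y using assms(2) that by (meson bij_is_inj injD)
  show ?thesis unfolding clinear_iff
    by (auto intro!: inj simp: A clinear_add[OF assms(1)] clinear_scale[OF assms(1)])
qed

lemma linear_part_comp:
  assumes "complex_affine F"
  shows "linear_part (F \<circ> H) = linear_part F \<circ> linear_part H"
proof
  fix v
  have "linear_part F (H v - H 0) = linear_part F (H v) - linear_part F (H 0)"
    using clinear_diff[OF clinear_linear_part[OF assms]] .
  then show "linear_part (F \<circ> H) v = (linear_part F \<circ> linear_part H) v"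
    by (simp add: linear_part_def)
qed

lemma complex_affine_comp:
  assumes "complex_affine F" "complex_affine H"
  shows "complex_affine (F \<circ> H)"
  using clinear_comp[OF clinear_linear_part[OF assms(1)] clinear_linear_part[OF assms(2)]]
  unfolding linear_part_comp[OF assms(1), symmetric]
  by (simp add: complex_affine_def linear_part_def[abs_def])

lemma complex_affine_translation: "complex_affine (\<lambda>v. v + b)"
  and linear_part_translation: "linear_part (\<lambda>v. v + b) = (\<lambda>v. v)"
  by (rule complex_affineI[OF clinear_id], rule linear_part_affine[OF clinear_id])

lemma bij_linear_part:
  assumes "bij F" shows "bij (linear_part F)"
proof -
  have "linear_part F = (\<lambda>v. v - F 0) \<circ> F" by (auto simp: linear_part_def)
  moreover have "bij (\<lambda>v. v - F 0)" by (rule o_bij[of "\<lambda>v. v + F 0"]) auto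
  ultimately show ?thesis using assms bij_comp by metis
qed

lemma complex_affine_inv:
  assumes "complex_affine F" "bij F"
  shows "complex_affine (inv_into UNIV F)" and "linear_part (inv_into UNIV F) = inv_into UNIV (linear_part F)"
proof -
  let ?A = "linear_part F"
  note A = clinear_linear_part[OF assms(1)]
  note A' = clinear_inv[OF A bij_linear_part[OF assms(2)]]
  have "inv_into UNIV F = (\<lambda>v. inv_into UNIV ?A v + (- inv_into UNIV ?A (F 0)))"
  proof (rule Hilbert_Choice.inv_equality)
    show "F (inv_into UNIV ?A y + - inv_into UNIV ?A (F 0)) = y" for y
      using bij_linear_part[OF assms(2)]
      by (subst affine_eq[of F]) (simp add: clinear_diff[OF A] bij_is_surj surj_f_inv_f)
    show "inv_into UNIV ?A (F x) + - inv_into UNIV ?A (F 0) = x" for x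
      using bij_linear_part[OF assms(2)]
      by (subst affine_eq[of F]) (simp add: clinear_add[OF A'] bij_is_inj)
  qed
  then show "complex_affine (inv_into UNIV F)" "linear_part (inv_into UNIV F) = inv_into UNIV ?A"
    using complex_affineI[OF A'] linear_part_affine[OF A'] by metis+
qed

lemma complex_affine_has_derivative:
  assumes "complex_affine F" shows "(F has_derivative linear_part F) (at v)"
proof -
  have "((\<lambda>v. linear_part F v + F 0) has_derivative linear_part F) (at v)"
    using bounded_linear_imp_has_derivative[OF clinear_bounded_linear[OF clinear_linear_part[OF assms]]]
    by (intro has_derivative_add_const)
  then show ?thesis by (simp only: affine_eq[symmetric])
qed

lemma complex_affine_continuous: "complex_affine F \<Longrightarrow> continuous_on UNIV F"
  by (meson complex_affine_has_derivative continuous_at_imp_continuous_on has_derivative_continuous)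

section \<open>Liouville's theorem for maps that commute with a cocompact set of translations\<close>

text \<open>
  Every increment \<open>F (v + w) - F v\<close> with \<open>norm w \<le> 1\<close> is unchanged when \<open>v\<close> moves by an element of \<open>\<Lambda>\<close>,
  hence is bounded by its values over a compact set of \<open>v\<close>. So \<open>F\<close> grows at most linearly. On each
  complex line through the origin Liouville's theorem in one variable then makes every component of
  \<open>F\<close> a polynomial of degree at most one, whose linear coefficient is the derivative of \<open>F\<close> at
  the origin.
\<close>

lemma entire_translation_equivariant_affine:
  fixes F :: "complex ^ 'n \<Rightarrow> complex ^ 'n"
  assumes hol: "cn_holomorphic_on F UNIV"
    and cocompact: "\<And>v. \<exists>l\<in>\<Lambda>. norm (v - l) \<le> R"
    and equivariant: "\<And>l. l \<in> \<Lambda> \<Longrightarrow> \<exists>c. \<forall>v. F (v + l) = F v + c"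
  shows "complex_affine F"
proof -
  have der: "\<exists>D. (F has_derivative D) (at v) \<and> (\<forall>c w. D (c *s w) = c *s D w)" for v
    using hol by (simp add: cn_holomorphic_on_def)
  have "continuous_on UNIV F"
    using der by (meson continuous_at_imp_continuous_on has_derivative_continuous)
  then have "bounded (F ` cball 0 (R + 1))"
    by (metis compact_cball compact_continuous_image compact_imp_bounded continuous_on_subset subset_UNIV)
  then obtain C where "\<And>w. w \<in> F ` cball 0 (R + 1) \<Longrightarrow> norm w \<le> C"
    unfolding bounded_iff by blast
  then have C: "norm (F v) \<le> C" if "norm v \<le> R + 1" for v
    using that by (metis imageI mem_cball_0)
  have step: "norm (F (v + w) - F v) \<le> 2 * C" if "norm w \<le> 1" for v w
  proof -
    obtain l where l: "l \<in> \<Lambda>" "norm (v - l) \<le> R" using cocompact by blast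
    obtain c where c: "\<And>u. F (u + l) = F u + c" using equivariant l(1) by blast
    have "norm (v - l + w) \<le> R + 1" using l(2) that norm_triangle_mono by blast
    moreover have "norm (v - l) \<le> R + 1" using l(2) by linarith
    ultimately have "norm (F (v - l + w) - F (v - l)) \<le> C + C"
      using C[of "v - l + w"] C[of "v - l"] norm_triangle_ineq4[of "F (v - l + w)" "F (v - l)"] by linarith
    moreover have "F (v - l + w) - F (v - l) = F (v + w) - F v"
      using c[of "v - l + w"] c[of "v - l"] by (simp add: algebra_simps)
    ultimately show ?thesis by simp
  qed
  have growth: "norm v \<le> of_nat n \<Longrightarrow> norm (F v - F 0) \<le> of_nat n * (2 * C)" for n v
  proof (induction n arbitrary: v)
    case (Suc n)
    let ?u = "(of_nat n / of_nat (Suc n)) *\<^sub>R v"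
    have "norm ?u \<le> of_nat n / of_nat (Suc n) * of_nat (Suc n)"
      unfolding norm_scaleR using Suc.prems by (intro mult_mono) auto
    then have u: "norm (F ?u - F 0) \<le> of_nat n * (2 * C)" by (intro Suc.IH) simp
    have "of_nat n / of_nat (Suc n) + 1 / of_nat (Suc n) = (1 :: real)" by (simp add: field_simps)
    then have "?u + (1 / of_nat (Suc n)) *\<^sub>R v = v"
      unfolding scaleR_add_left[symmetric] by (simp only: scaleR_one)
    then have "v - ?u = (1 / of_nat (Suc n)) *\<^sub>R v" by (simp only: diff_eq_eq add.commute)
    moreover have "norm ((1 / of_nat (Suc n)) *\<^sub>R v) \<le> 1"
      using Suc.prems by (simp add: divide_le_eq)
    ultimately have "norm (v - ?u) \<le> 1" by (simp only:)
    then have "norm (F (?u + (v - ?u)) - F ?u) \<le> 2 * C" by (rule step)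
    then have "norm ((F v - F ?u) + (F ?u - F 0)) \<le> 2 * C + of_nat n * (2 * C)"
      using u by (intro norm_triangle_mono) auto
    then show ?case by (simp add: algebra_simps)
  qed simp
  have C0: "C \<ge> 0" using step[of 0 0] by simp
  have linear_growth: "norm (F v) \<le> norm (F 0) + (norm v + 1) * (2 * C)" for v
  proof -
    have "norm (F v - F 0) \<le> of_nat (nat \<lceil>norm v\<rceil>) * (2 * C)" by (rule growth) linarith
    also have "\<dots> \<le> (norm v + 1) * (2 * C)"
    proof (rule mult_right_mono)
      have "0 \<le> \<lceil>norm v\<rceil>" by (simp add: order_less_le_trans[of "- 1" 0])
      then show "of_nat (nat \<lceil>norm v\<rceil>) \<le> norm v + 1"
        using of_int_ceiling_le_add_one[of "norm v"] by simp
    qed (use C0 in simp)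
    finally show ?thesis using norm_triangle_sub[of "F v" "F 0"] by linarith
  qed
  obtain D where D: "(F has_derivative D) (at 0)" "\<And>c w. D (c *s w) = c *s D w" using der by blast
  have eq: "F v = D v + F 0" for v
  proof (subst vec_eq_iff, intro allI)
    fix i
    define \<phi> where "\<phi> \<zeta> = F (\<zeta> *s v) $ i" for \<zeta>
    have scale_bl: "bounded_linear (\<lambda>\<zeta>::complex. \<zeta> *s v)"
      unfolding linear_conv_bounded_linear[symmetric]
      by (intro linearI) (auto simp: vec_eq_iff algebra_simps)
    have \<phi>_der: "(\<phi> has_field_derivative (D' v $ i)) (at \<zeta>)"
      if "(F has_derivative D') (at (\<zeta> *s v))" "\<And>c w. D' (c *s w) = c *s D' w" for D' \<zeta>
    proof -
      have "((\<lambda>\<zeta>. F (\<zeta> *s v)) has_derivative (\<lambda>h. D' (h *s v))) (at \<zeta>)"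
        by (rule has_derivative_compose[OF bounded_linear_imp_has_derivative[OF scale_bl] that(1)])
      from bounded_linear.has_derivative[OF bounded_linear_vec_nth this, of i]
      show ?thesis unfolding \<phi>_def has_field_derivative_def
        by (rule has_derivative_eq_rhs) (auto simp: that(2))
    qed
    have "\<phi> holomorphic_on UNIV"
      unfolding holomorphic_on_def field_differentiable_def
      using der \<phi>_der by meson
    moreover have "norm (\<phi> \<zeta>) \<le> (norm (F 0) + (norm v + 1) * (2 * C)) * norm \<zeta> ^ 1"
      if "1 \<le> norm \<zeta>" for \<zeta>
    proof -
      have norm_eq: "norm (\<zeta> *s v) = norm \<zeta> * norm v"
        by (simp add: norm_vec_def L2_set_right_distrib norm_mult)
      have "norm (\<phi> \<zeta>) \<le> norm (F (\<zeta> *s v))" unfolding \<phi>_def by (rule Finite_Cartesian_Product.norm_nth_le)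
      also have "\<dots> \<le> norm (F 0) + (norm \<zeta> * norm v + 1) * (2 * C)"
        using linear_growth[of "\<zeta> *s v"] norm_eq by simp
      also have "\<dots> \<le> norm \<zeta> * norm (F 0) + (norm \<zeta> * norm v + norm \<zeta>) * (2 * C)"
        using that C0 mult_right_mono[OF that, of "norm (F 0)"]
        by (intro add_mono mult_right_mono) auto
      finally show ?thesis by (simp add: algebra_simps)
    qed
    ultimately have "\<phi> 1 = (\<Sum>k\<le>1. (deriv ^^ k) \<phi> 0 / fact k * 1 ^ k)"
      by (rule Liouville_polynomial)
    moreover have "deriv \<phi> 0 = D v $ i" using \<phi>_der[of D 0] D by (intro DERIV_imp_deriv) simp
    ultimately show "F v $ i = (D v + F 0) $ i" by (simp add: \<phi>_def)
  qed
  have "clinear D"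
    using D(2) bounded_linear.linear[OF has_derivative_bounded_linear[OF D(1)]]
    by (simp add: clinear_iff linear_add)
  then have "complex_affine (\<lambda>v. D v + F 0)" by (rule complex_affineI)
  then show ?thesis by (simp only: eq[symmetric])
qed

section \<open>Biholomorphic self-maps of flat quotients\<close>

lemma topspace_quot_topology: "topspace (quot_topology p) = range p"
proof
  show "topspace (quot_topology p) \<subseteq> range p"
    using openin_topspace[of "quot_topology p"] unfolding openin_quot_topology by (rule conjunct1)
  have "p -` range p = UNIV" by blast
  then have "openin (quot_topology p) (range p)" by (simp add: openin_quot_topology)
  then show "range p \<subseteq> topspace (quot_topology p)" by (rule openin_subset)
qed

text \<open>
  A free and properly discontinuous group of complex affine maps whose translations are exactly those
  by a lattice. The last axiom is the form in which the finite index of the lattice is used: it puts a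
  fixed power of every element of \<open>\<Gamma>\<close> into the lattice. The torus itself is the case \<open>N = 1\<close>.
\<close>

locale flat_quotient = free_quotient \<Gamma> p
  for \<Gamma> :: "(complex ^ 'n \<Rightarrow> complex ^ 'n) set" and p :: "complex ^ 'n \<Rightarrow> 'a" +
  fixes L :: "(complex ^ 'n) set"
  assumes affine: "\<gamma> \<in> \<Gamma> \<Longrightarrow> complex_affine \<gamma>"
    and lattice: "is_lattice L"
    and translation_iff: "(\<lambda>v. v + b) \<in> \<Gamma> \<longleftrightarrow> b \<in> L"
    and power_translation: "\<exists>N>0. \<forall>\<gamma>\<in>\<Gamma>. \<exists>l\<in>L. \<gamma> ^^ N = (\<lambda>v. v + l)"
begin

text \<open>
  The condition on \<open>p\<close> says that \<open>F\<close> permutes the orbits of \<open>\<Gamma>\<close>, or that \<open>F\<close> normalises \<open>\<Gamma>\<close>.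
\<close>

definition lifts :: "(complex ^ 'n \<Rightarrow> complex ^ 'n) set"
  where "lifts = {F. complex_affine F \<and> bij F \<and> (\<forall>v w. p (F v) = p (F w) \<longleftrightarrow> p v = p w)}"

lemma liftsD:
  assumes "F \<in> lifts"
  shows "complex_affine F" "bij F" "p (F v) = p (F w) \<longleftrightarrow> p v = p w"
  using assms by (auto simp: lifts_def)

lemma lifts_comp: "F \<in> lifts \<Longrightarrow> H \<in> lifts \<Longrightarrow> F \<circ> H \<in> lifts"
  by (auto simp: lifts_def complex_affine_comp bij_comp)

lemma lifts_inv:
  assumes "F \<in> lifts" shows "inv_into UNIV F \<in> lifts"
proof -
  have "F (inv_into UNIV F v) = v" for v using liftsD(2)[OF assms] by (simp add: bij_is_surj surj_f_inv_f)
  then have "p (inv_into UNIV F v) = p (inv_into UNIV F w) \<longleftrightarrow> p v = p w" for v w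
    using liftsD(3)[OF assms, of "inv_into UNIV F v" "inv_into UNIV F w"] by simp
  then show ?thesis
    using liftsD[OF assms] by (simp add: lifts_def complex_affine_inv bij_imp_bij_inv)
qed

lemma deck_lifts: "\<gamma> \<in> \<Gamma> \<Longrightarrow> \<gamma> \<in> lifts"
  by (simp add: lifts_def affine bij_deck p_deck)

lemma lifts_conjugate:
  assumes "F \<in> lifts" "\<gamma> \<in> \<Gamma>"
  obtains \<delta> where "\<delta> \<in> \<Gamma>" "F \<circ> \<gamma> = \<delta> \<circ> F"
proof (rule lift_unique[of F "F \<circ> \<gamma>"])
  show "continuous_on UNIV F" "continuous_on UNIV (F \<circ> \<gamma>)"
    using complex_affine_continuous complex_affine_comp liftsD(1)[OF assms(1)] affine[OF assms(2)]
    by blast+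
  show "p (F u) = p ((F \<circ> \<gamma>) u)" for u
    using liftsD(3)[OF assms(1), of u "\<gamma> u"] p_deck[OF assms(2)] by simp
qed (use that in blast)

text \<open>
  Conjugation by \<open>F\<close> preserves \<open>\<Gamma>\<close> and turns the translation by \<open>l\<close> into the translation by
  \<open>linear_part F l\<close>; and the translations in \<open>\<Gamma>\<close> are those by elements of \<open>L\<close>.
\<close>

lemma linear_part_lifts_lattice:
  assumes "F \<in> lifts" shows "linear_part F ` L = L"
proof -
  have sub: "linear_part F l \<in> L" if F: "F \<in> lifts" and l: "l \<in> L" for F l
  proof -
    obtain \<delta> where \<delta>: "\<delta> \<in> \<Gamma>" "F \<circ> (\<lambda>v. v + l) = \<delta> \<circ> F"
      using lifts_conjugate F translation_iff l by blast
    have "\<delta> = (\<lambda>v. v + linear_part F l)"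
    proof
      fix w
      obtain v where w: "w = F v" using liftsD(2)[OF F] by (metis bij_pointE)
      have "\<delta> w = F (v + l)" using \<delta>(2) w by (metis comp_apply)
      also have "\<dots> = F v + linear_part F l"
        using clinear_add[OF clinear_linear_part[OF liftsD(1)[OF F]], of v l]
          affine_eq[of F v] affine_eq[of F "v + l"] by simp
      finally show "\<delta> w = w + linear_part F l" using w by simp
    qed
    then show ?thesis using \<delta>(1) translation_iff by simp
  qed
  have "l \<in> linear_part F ` L" if "l \<in> L" for l
  proof
    show "inv_into UNIV (linear_part F) l \<in> L"
      using sub[OF lifts_inv[OF assms] that] complex_affine_inv(2)[OF liftsD(1,2)[OF assms]] by simp
    show "l = linear_part F (inv_into UNIV (linear_part F) l)"
      using bij_linear_part[OF liftsD(2)[OF assms]] by (simp add: bij_is_surj surj_f_inv_f)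
  qed
  then show ?thesis using sub[OF assms] by blast
qed

text \<open>
  In any pair of charts the map is locally \<open>\<gamma> \<circ> F\<close> for some \<open>\<gamma>\<close> in \<open>\<Gamma>\<close>.
\<close>

lemma descent_holomorphic:
  assumes F: "F \<in> lifts" and f: "\<And>v. f (p v) = p (F v)"
  shows "holomorphic_map p p f"
  unfolding holomorphic_map_def
proof (intro conjI allI impI)
  have cont: "continuous_on UNIV F" using complex_affine_continuous liftsD(1)[OF F] .
  show "continuous_map (quot_topology p) (quot_topology p) f"
    unfolding continuous_map_def
  proof (intro conjI allI impI)
    note top = topspace_quot_topology[of p]
    show "f \<in> topspace (quot_topology p) \<rightarrow> topspace (quot_topology p)"
      unfolding top using f by auto
    fix W assume W: "openin (quot_topology p) W"
    have "p -` {x \<in> range p. f x \<in> W} = F -` (p -` W)" using f by auto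
    moreover have "open (F -` (p -` W))"
      using W cont unfolding openin_quot_topology
      by (metis continuous_on_open_vimage open_UNIV Int_UNIV_right)
    ultimately show "openin (quot_topology p) {x \<in> topspace (quot_topology p). f x \<in> W}"
      unfolding openin_quot_topology top by auto
  qed
next
  fix U U' assume U: "chart_domain p U" and U': "chart_domain p U'"
  show "cn_holomorphic_on (\<lambda>u. inv_into U' p (f (p u))) {u \<in> U. f (p u) \<in> p ` U'}"
    unfolding cn_holomorphic_on_def
  proof
    fix u assume "u \<in> {u \<in> U. f (p u) \<in> p ` U'}"
    then obtain u' where u': "u' \<in> U'" "p (F u) = p u'" using f by auto
    then obtain \<gamma> where \<gamma>: "\<gamma> \<in> \<Gamma>" "u' = \<gamma> (F u)" using fibre by blast
    have F': "complex_affine (\<gamma> \<circ> F)" using complex_affine_comp affine \<gamma>(1) liftsD(1)[OF F] by blast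
    let ?S = "(\<gamma> \<circ> F) -` U'"
    have "open ?S" using complex_affine_continuous[OF F'] U' unfolding chart_domain_def
      by (metis continuous_on_open_vimage open_UNIV Int_UNIV_right)
    moreover have "(\<gamma> \<circ> F) x = inv_into U' p (f (p x))" if "x \<in> ?S" for x
    proof -
      have "f (p x) = p ((\<gamma> \<circ> F) x)" using f p_deck[OF \<gamma>(1)] by simp
      then show ?thesis using that U' unfolding chart_domain_def by (metis inv_into_f_f vimageE)
    qed
    ultimately have "((\<lambda>u. inv_into U' p (f (p u))) has_derivative linear_part (\<gamma> \<circ> F)) (at u)"
      using has_derivative_transform_within_open[OF complex_affine_has_derivative[OF F', of u], of ?S]
        u' \<gamma> by auto
    then show "\<exists>D. ((\<lambda>u. inv_into U' p (f (p u))) has_derivative D) (at u)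
        \<and> (\<forall>c v. D (c *s v) = c *s D v)"
      using clinear_scale[OF clinear_linear_part[OF F']] by blast
  qed
qed

lemma holomorphic_lift:
  assumes hol: "holomorphic_map p p f" and f: "f ` range p \<subseteq> range p"
  obtains F where "continuous_on UNIV F" "cn_holomorphic_on F UNIV" "\<And>v. p (F v) = f (p v)"
proof -
  note top = topspace_quot_topology[of p]
  have h_open: "open ((\<lambda>v. f (p v)) -` (p ` U))" if "open U" for U
  proof -
    have "openin (quot_topology p) (p ` U)"
      using open_saturation[OF that] by (auto simp: openin_quot_topology)
    then have "openin (quot_topology p) {x \<in> range p. f x \<in> p ` U}"
      using hol top by (auto simp: holomorphic_map_def continuous_map_def)
    then have "open (p -` {x \<in> range p. f x \<in> p ` U})" by (simp add: openin_quot_topology)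
    moreover have "p -` {x \<in> range p. f x \<in> p ` U} = (\<lambda>v. f (p v)) -` (p ` U)" by auto
    ultimately show ?thesis by simp
  qed
  obtain F where F: "continuous_on UNIV F" "\<And>v. p (F v) = f (p v)"
    using lift_exists[of "\<lambda>v. f (p v)"] h_open f by blast
  have "cn_holomorphic_on F UNIV"
    unfolding cn_holomorphic_on_def
  proof
    fix u :: "complex ^ 'n"
    obtain U where U: "chart_domain p U" "u \<in> U" by (rule chart_at)
    obtain W where W: "chart_domain p W" "F u \<in> W" by (rule chart_at)
    have "cn_holomorphic_on (\<lambda>u. inv_into W p (f (p u))) {u \<in> U. f (p u) \<in> p ` W}"
      using hol U W by (simp add: holomorphic_map_def)
    moreover have "f (p u) \<in> p ` W" using F(2)[of u] W(2) by (metis imageI)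
    ultimately obtain D where D: "((\<lambda>u. inv_into W p (f (p u))) has_derivative D) (at u)"
        "\<forall>c v. D (c *s v) = c *s D v"
      using U(2) by (auto simp: cn_holomorphic_on_def)
    have "open (F -` W)" using F(1) W(1) unfolding chart_domain_def
      by (metis continuous_on_open_vimage open_UNIV Int_UNIV_right)
    moreover have "inv_into W p (f (p x)) = F x" if "x \<in> F -` W" for x
      using that F(2)[of x] W(1) unfolding chart_domain_def by (metis inv_into_f_f vimageE)
    ultimately have "(F has_derivative D) (at u)"
      using has_derivative_transform_within_open[OF D(1), of "F -` W"] W(2) by auto
    then show "\<exists>D. (F has_derivative D) (at u) \<and> (\<forall>c v. D (c *s v) = c *s D v)"
      using D(2) by blast
  qed
  then show ?thesis using that F by blast
qed

text \<open>
  For \<open>l\<close> in \<open>L\<close> the maps \<open>v \<mapsto> F (v + l)\<close> and \<open>F\<close> lift the same map, so they differ by some \<open>\<gamma>\<close> in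
  \<open>\<Gamma>\<close>, which need not be a translation. But \<open>F (v + N l)\<close> is \<open>(\<gamma> ^^ N) (F v)\<close>, and \<open>\<gamma> ^^ N\<close> is a
  translation by \<open>power_translation\<close>. So Liouville's theorem applies with the cocompact set
  \<open>N L\<close> in place of \<open>L\<close>.
\<close>

lemma entire_lift_affine:
  assumes F: "continuous_on UNIV F" "cn_holomorphic_on F UNIV"
    and eq: "\<And>v w. p v = p w \<Longrightarrow> p (F v) = p (F w)"
  shows "complex_affine F"
proof -
  obtain N where N: "N > 0" "\<forall>\<gamma>\<in>\<Gamma>. \<exists>l\<in>L. \<gamma> ^^ N = (\<lambda>v. v + l)"
    using power_translation by blast
  obtain R where R: "\<And>v. \<exists>l\<in>L. norm (v - l) \<le> R" using lattice_cocompact[OF lattice] by metis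
  show ?thesis
  proof (rule entire_translation_equivariant_affine[OF F(2), of "(\<lambda>l. of_nat N *\<^sub>R l) ` L" "of_nat N * R"])
    fix v
    obtain l where l: "l \<in> L" "norm ((1 / of_nat N) *\<^sub>R v - l) \<le> R" using R by blast
    have "norm (v - of_nat N *\<^sub>R l) = of_nat N * norm ((1 / of_nat N) *\<^sub>R v - l)"
    proof -
      have "v - of_nat N *\<^sub>R l = of_nat N *\<^sub>R ((1 / of_nat N) *\<^sub>R v - l)"
        using N(1) by (simp add: scaleR_diff_right)
      then show ?thesis by (metis norm_scaleR abs_of_nat)
    qed
    also have "\<dots> \<le> of_nat N * R" using l(2) by (intro mult_left_mono) auto
    finally show "\<exists>l\<in>(\<lambda>l. of_nat N *\<^sub>R l) ` L. norm (v - l) \<le> of_nat N * R" using l(1) by blast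
  next
    fix l' assume "l' \<in> (\<lambda>l. of_nat N *\<^sub>R l) ` L"
    then obtain l where l: "l \<in> L" "l' = of_nat N *\<^sub>R l" by blast
    have tr: "(\<lambda>v. v + l) \<in> \<Gamma>" using translation_iff l(1) by simp
    have "continuous_on UNIV (F \<circ> (\<lambda>v. v + l))"
      using F(1) continuous[OF tr] by (metis continuous_on_compose continuous_on_subset subset_UNIV)
    moreover have "p (F v) = p ((F \<circ> (\<lambda>v. v + l)) v)" for v
      using eq[of v "v + l"] p_deck[OF tr, of v] by simp
    ultimately obtain \<gamma> where \<gamma>: "\<gamma> \<in> \<Gamma>" "F \<circ> (\<lambda>v. v + l) = \<gamma> \<circ> F"
      using lift_unique[OF F(1)] by blast
    have "F (v + of_nat k *\<^sub>R l) = (\<gamma> ^^ k) (F v)" for v k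
    proof (induction k)
      case (Suc k)
      have "F (v + of_nat (Suc k) *\<^sub>R l) = (F \<circ> (\<lambda>v. v + l)) (v + of_nat k *\<^sub>R l)"
        by (simp add: algebra_simps)
      also have "\<dots> = (\<gamma> ^^ Suc k) (F v)" by (simp add: \<gamma>(2) Suc)
      finally show ?case .
    qed simp
    moreover obtain m where "\<gamma> ^^ N = (\<lambda>v. v + m)" using N(2) \<gamma>(1) by blast
    ultimately show "\<exists>c. \<forall>v. F (v + l') = F v + c" using l(2) by auto
  qed
qed

text \<open>
  Both \<open>f\<close> and its inverse have affine lifts; their composites lift the identity, so they lie in \<open>\<Gamma>\<close>,
  and the lift of \<open>f\<close> is bijective.
\<close>

theorem biholomorphic_lift:
  assumes "f \<in> biholomorphic_self_maps p"
  obtains F where "F \<in> lifts" "\<And>v. f (p v) = p (F v)"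
proof -
  let ?f' = "inv_into (range p) f"
  have f: "bij_betw f (range p) (range p)" "holomorphic_map p p f" "holomorphic_map p p ?f'"
    using assms by (auto simp: biholomorphic_self_maps_def Bij_def)
  have f': "bij_betw ?f' (range p) (range p)" using bij_betw_inv_into f(1) .
  obtain F where F: "continuous_on UNIV F" "cn_holomorphic_on F UNIV" "\<And>v. p (F v) = f (p v)"
    using holomorphic_lift[OF f(2)] f(1) by (metis bij_betw_imp_surj_on order_refl)
  obtain F' where F': "continuous_on UNIV F'" "cn_holomorphic_on F' UNIV" "\<And>v. p (F' v) = ?f' (p v)"
    using holomorphic_lift[OF f(3)] f' by (metis bij_betw_imp_surj_on order_refl)
  have affF: "complex_affine F" by (rule entire_lift_affine[OF F(1,2)]) (simp add: F(3))
  have affF': "complex_affine F'" by (rule entire_lift_affine[OF F'(1,2)]) (simp add: F'(3))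
  have eq: "p (id v) = p ((F' \<circ> F) v)" "p (id v) = p ((F \<circ> F') v)" for v
    using f(1) by (auto simp: F(3) F'(3) bij_betw_inv_into_left bij_betw_inv_into_right)
  have cont: "continuous_on UNIV (F' \<circ> F)" "continuous_on UNIV (F \<circ> F')"
    using complex_affine_comp affF affF' complex_affine_continuous by blast+
  obtain \<gamma> where \<gamma>: "\<gamma> \<in> \<Gamma>" "F' \<circ> F = \<gamma> \<circ> id"
    by (rule lift_unique[OF _ cont(1) eq(1)]) (auto simp: id_def)
  obtain \<gamma>' where \<gamma>': "\<gamma>' \<in> \<Gamma>" "F \<circ> F' = \<gamma>' \<circ> id"
    by (rule lift_unique[OF _ cont(2) eq(2)]) (auto simp: id_def)
  have "bij (F' \<circ> F)" "bij (F \<circ> F')" using bij_deck \<gamma> \<gamma>' by auto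
  then have "inj (F' \<circ> F)" "range (F \<circ> F') = UNIV" by (simp_all only: bij_def)
  then have "bij F" unfolding bij_def by (metis inj_on_imageI2 image_comp image_mono subset_UNIV top.extremum_uniqueI)
  moreover have "p (F v) = p (F w) \<longleftrightarrow> p v = p w" for v w
    unfolding F(3) using f(1) by (metis bij_betw_inv_into_left rangeI)
  ultimately have "F \<in> lifts" using affF by (simp add: lifts_def)
  then show ?thesis using that F(3) by metis
qed

lemma descent_biholomorphic:
  assumes F: "F \<in> lifts" and ext: "f \<in> extensional (range p)" and f: "\<And>v. f (p v) = p (F v)"
  shows "f \<in> biholomorphic_self_maps p"
proof -
  have surj: "F (inv_into UNIV F v) = v" for v using liftsD(2)[OF F] by (simp add: bij_is_surj surj_f_inv_f)
  have bij: "bij_betw f (range p) (range p)"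
    unfolding bij_betw_def
  proof
    show "inj_on f (range p)" using f liftsD(3)[OF F] by (auto intro!: inj_onI)
    show "f ` range p = range p" using f surj by (auto simp: image_iff) metis
  qed
  have "inv_into (range p) f (p v) = p (inv_into UNIV F v)" for v
    using bij_betw_inv_into_left[OF bij, of "p (inv_into UNIV F v)"] f surj by simp
  then have "holomorphic_map p p (inv_into (range p) f)"
    by (rule descent_holomorphic[OF lifts_inv[OF F]])
  then show ?thesis
    using bij ext descent_holomorphic[of F f, OF F f] by (simp add: biholomorphic_self_maps_def Bij_def)
qed

definition descend :: "(complex ^ 'n \<Rightarrow> complex ^ 'n) \<Rightarrow> 'a \<Rightarrow> 'a"
  where "descend F = (\<lambda>x\<in>range p. p (F (inv_into UNIV p x)))"

lemma descend_apply:
  assumes "F \<in> lifts" shows "descend F (p v) = p (F v)"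
proof -
  have "p (inv_into UNIV p (p v)) = p v" by (simp add: f_inv_into_f)
  then have "p (F (inv_into UNIV p (p v))) = p (F v)" using liftsD(3)[OF assms] by blast
  then show ?thesis by (simp add: descend_def)
qed

lemma carrier_Aut: "carrier (Aut p) = biholomorphic_self_maps p"
  by (simp add: Aut_def)

lemma descend_mem:
  assumes "F \<in> lifts" shows "descend F \<in> carrier (Aut p)"
  unfolding carrier_Aut
proof (rule descent_biholomorphic[OF assms])
  show "descend F \<in> extensional (range p)" by (simp add: descend_def)
  show "descend F (p v) = p (F v)" for v using descend_apply[OF assms] .
qed

lemma Aut_eqI:
  assumes "f \<in> carrier (Aut p)" "g \<in> carrier (Aut p)" "\<And>v. f (p v) = g (p v)"
  shows "f = g"
  using assms unfolding carrier_Aut biholomorphic_self_maps_def Bij_def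
  by (auto intro: extensionalityI)

lemma Aut_lift:
  assumes "f \<in> carrier (Aut p)"
  obtains F where "F \<in> lifts" "f = descend F"
proof -
  obtain F where "F \<in> lifts" "\<And>v. f (p v) = p (F v)"
    using biholomorphic_lift assms carrier_Aut by blast
  then have "f = descend F" by (intro Aut_eqI[OF assms]) (auto simp: descend_mem descend_apply)
  then show ?thesis using that \<open>F \<in> lifts\<close> by blast
qed

lemma mult_Aut: "f \<in> carrier (Aut p) \<Longrightarrow> g \<in> carrier (Aut p) \<Longrightarrow> f \<otimes>\<^bsub>Aut p\<^esub> g = compose (range p) f g"
  by (simp add: Aut_def BijGroup_def biholomorphic_self_maps_def)

lemma descend_comp:
  assumes "F \<in> lifts" "H \<in> lifts"
  shows "descend F \<otimes>\<^bsub>Aut p\<^esub> descend H = descend (F \<circ> H)"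
  unfolding mult_Aut[OF descend_mem[OF assms(1)] descend_mem[OF assms(2)]]
proof (rule extensionalityI[of _ "range p"])
  show "compose (range p) (descend F) (descend H) \<in> extensional (range p)" by (rule compose_extensional)
  show "descend (F \<circ> H) \<in> extensional (range p)" by (simp add: descend_def)
  show "compose (range p) (descend F) (descend H) x = descend (F \<circ> H) x" if "x \<in> range p" for x
    using that by (auto simp: compose_eq descend_apply assms lifts_comp)
qed

lemma id_lifts: "id \<in> lifts" by (simp add: deck_lifts id_mem)

lemma one_Aut: "\<one>\<^bsub>Aut p\<^esub> = descend id"
  by (rule ext) (auto simp: Aut_def BijGroup_def descend_def f_inv_into_f)

lemma lifts_inv_comp: "F \<in> lifts \<Longrightarrow> inv_into UNIV F \<circ> F = id" "F \<in> lifts \<Longrightarrow> F \<circ> inv_into UNIV F = id"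
  by (auto simp: fun_eq_iff bij_is_inj bij_is_surj surj_f_inv_f dest: liftsD(2))

lemma group_Aut: "Group.group (Aut p)"
proof (rule groupI)
  show "\<one>\<^bsub>Aut p\<^esub> \<in> carrier (Aut p)" by (simp add: one_Aut descend_mem id_lifts)
next
  fix f g assume "f \<in> carrier (Aut p)" "g \<in> carrier (Aut p)"
  then show "f \<otimes>\<^bsub>Aut p\<^esub> g \<in> carrier (Aut p)"
    by (elim Aut_lift) (simp add: descend_comp descend_mem lifts_comp)
next
  fix f g h assume "f \<in> carrier (Aut p)" "g \<in> carrier (Aut p)" "h \<in> carrier (Aut p)"
  then show "f \<otimes>\<^bsub>Aut p\<^esub> g \<otimes>\<^bsub>Aut p\<^esub> h = f \<otimes>\<^bsub>Aut p\<^esub> (g \<otimes>\<^bsub>Aut p\<^esub> h)"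
    by (elim Aut_lift) (simp add: descend_comp lifts_comp comp_assoc)
next
  fix f assume "f \<in> carrier (Aut p)"
  then obtain F where F: "F \<in> lifts" "f = descend F" by (rule Aut_lift)
  then show "\<one>\<^bsub>Aut p\<^esub> \<otimes>\<^bsub>Aut p\<^esub> f = f" by (simp add: one_Aut descend_comp id_lifts)
  show "\<exists>g\<in>carrier (Aut p). g \<otimes>\<^bsub>Aut p\<^esub> f = \<one>\<^bsub>Aut p\<^esub>"
    using F by (intro bexI[of _ "descend (inv_into UNIV F)"])
      (auto simp: one_Aut descend_comp lifts_inv descend_mem lifts_inv_comp)
qed

text \<open>
  Together with \<open>Aut_lift\<close> and \<open>descend_comp\<close> this identifies \<open>Aut p\<close> with the group of lifts modulo \<open>\<Gamma>\<close>.
\<close>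

lemma descend_eq_iff:
  assumes "F \<in> lifts" "H \<in> lifts"
  shows "descend F = descend H \<longleftrightarrow> (\<exists>\<gamma>\<in>\<Gamma>. H = \<gamma> \<circ> F)"
proof
  assume "descend F = descend H"
  then have "p (F v) = p (H v)" for v using assms descend_apply by metis
  then show "\<exists>\<gamma>\<in>\<Gamma>. H = \<gamma> \<circ> F"
    using lift_unique[of F H] complex_affine_continuous liftsD(1) assms by metis
next
  assume "\<exists>\<gamma>\<in>\<Gamma>. H = \<gamma> \<circ> F"
  then show "descend F = descend H"
    by (auto intro!: Aut_eqI simp: descend_mem assms descend_apply p_deck lifts_comp deck_lifts)
qed

end

section \<open>The torus and its linear automorphisms\<close>

lemma torus_proj_eq: "torus_proj L v = {l + v | l. l \<in> L}"
  by (auto simp: torus_proj_def r_coset_def vector_group_def)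

lemma torus_proj_mult:
  assumes "is_lattice L"
  shows "torus_proj L v \<otimes>\<^bsub>torus L\<^esub> torus_proj L w = torus_proj L (v + w)"
proof -
  have "torus_proj L v \<otimes>\<^bsub>torus L\<^esub> torus_proj L w = {(l + v) + (m + w) | l m. l \<in> L \<and> m \<in> L}"
    by (auto simp: torus_def set_mult_def torus_proj_eq) (auto simp: vector_group_def)
  also have "\<dots> = torus_proj L (v + w)"
  proof
    show "{(l + v) + (m + w) | l m. l \<in> L \<and> m \<in> L} \<subseteq> torus_proj L (v + w)"
    proof clarify
      fix l m assume "l \<in> L" "m \<in> L"
      then show "(l + v) + (m + w) \<in> torus_proj L (v + w)"
        using lattice_add[OF assms] unfolding torus_proj_eq
        by (intro CollectI exI[of _ "l + m"]) (simp add: algebra_simps)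
    qed
    show "torus_proj L (v + w) \<subseteq> {(l + v) + (m + w) | l m. l \<in> L \<and> m \<in> L}"
    proof
      fix x assume "x \<in> torus_proj L (v + w)"
      then obtain l where "l \<in> L" "x = (l + v) + (0 + w)"
        unfolding torus_proj_eq by (auto simp: add.assoc)
      then show "x \<in> {(l + v) + (m + w) | l m. l \<in> L \<and> m \<in> L}"
        using lattice_zero[OF assms] by blast
    qed
  qed
  finally show ?thesis .
qed

lemma torus_one: "\<one>\<^bsub>torus L\<^esub> = torus_proj L 0"
  by (simp add: torus_def torus_proj_eq)

lemma torus_proj_eq_iff:
  assumes "is_lattice L"
  shows "torus_proj L v = torus_proj L w \<longleftrightarrow> w - v \<in> L"
proof
  assume "torus_proj L v = torus_proj L w"
  moreover have "w \<in> torus_proj L w"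
    unfolding torus_proj_eq using lattice_zero[OF assms] by force
  ultimately obtain l where "l \<in> L" "w = l + v" unfolding torus_proj_eq by blast
  then show "w - v \<in> L" by simp
next
  have sub: "torus_proj L w \<subseteq> torus_proj L v" if "w - v \<in> L" for v w
  proof
    fix x assume "x \<in> torus_proj L w"
    then obtain l where l: "l \<in> L" "x = l + w" unfolding torus_proj_eq by blast
    then have "x = (l + (w - v)) + v" by simp
    then show "x \<in> torus_proj L v" using lattice_add[OF assms l(1) that] unfolding torus_proj_eq by blast
  qed
  assume "w - v \<in> L"
  moreover from this have "v - w \<in> L" using lattice_uminus[OF assms] by force
  ultimately show "torus_proj L v = torus_proj L w" using sub by blast
qed

lemma torus_proj_in_carrier: "torus_proj L v \<in> carrier (torus L)"
  by (simp add: carrier_torus)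

lemma comm_group_torus:
  assumes "is_lattice L" shows "comm_group (torus L)"
proof (rule comm_groupI)
  fix x y assume "x \<in> carrier (torus L)" "y \<in> carrier (torus L)"
  then show "x \<otimes>\<^bsub>torus L\<^esub> y \<in> carrier (torus L)" "x \<otimes>\<^bsub>torus L\<^esub> y = y \<otimes>\<^bsub>torus L\<^esub> x"
    by (auto simp: carrier_torus torus_proj_mult assms add.commute)
next
  show "\<one>\<^bsub>torus L\<^esub> \<in> carrier (torus L)" by (simp add: carrier_torus torus_one)
next
  fix x y z assume "x \<in> carrier (torus L)" "y \<in> carrier (torus L)" "z \<in> carrier (torus L)"
  then show "x \<otimes>\<^bsub>torus L\<^esub> y \<otimes>\<^bsub>torus L\<^esub> z = x \<otimes>\<^bsub>torus L\<^esub> (y \<otimes>\<^bsub>torus L\<^esub> z)"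
    by (auto simp: carrier_torus torus_proj_mult assms add.assoc)
next
  fix x assume "x \<in> carrier (torus L)"
  then obtain v where x: "x = torus_proj L v" by (auto simp: carrier_torus)
  then show "\<one>\<^bsub>torus L\<^esub> \<otimes>\<^bsub>torus L\<^esub> x = x" by (simp add: torus_one torus_proj_mult assms)
  show "\<exists>y\<in>carrier (torus L). y \<otimes>\<^bsub>torus L\<^esub> x = \<one>\<^bsub>torus L\<^esub>"
    by (rule bexI[of _ "torus_proj L (- v)"])
      (simp_all add: x torus_one torus_proj_mult assms torus_proj_in_carrier)
qed

lemma torus_inv:
  assumes "is_lattice L"
  shows "inv\<^bsub>torus L\<^esub> torus_proj L v = torus_proj L (- v)"
proof -
  interpret comm_group "torus L" using comm_group_torus[OF assms] .
  show ?thesis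
    by (rule inv_equality) (simp_all add: torus_one torus_proj_mult assms torus_proj_in_carrier)
qed

text \<open>
  Two points of the coset \<open>u + L\<close> at distance less than \<open>e0\<close> coincide, so the ball of radius \<open>e0 / 2\<close>
  about the origin contains at most one of them. If there is one and it is not the origin, its norm
  serves as \<open>e\<close>.
\<close>

lemma lattice_coset_discrete:
  fixes L :: "(complex ^ 'n) set"
  assumes "is_lattice L"
  obtains e where "e > 0" "\<And>l. l \<in> L \<Longrightarrow> norm (u + l) < e \<Longrightarrow> u + l = 0"
proof -
  obtain e0 where e0: "e0 > 0" "\<And>l. l \<in> L \<Longrightarrow> norm l < e0 \<Longrightarrow> l = 0"
    using lattice_discrete[OF assms] by blast
  show ?thesis
  proof (cases "\<exists>l0\<in>L. u + l0 \<noteq> 0 \<and> norm (u + l0) < e0 / 2")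
    case True
    then obtain l0 where l0: "l0 \<in> L" "u + l0 \<noteq> 0" "norm (u + l0) < e0 / 2" by blast
    show ?thesis
    proof (rule that[of "norm (u + l0)"])
      show "norm (u + l0) > 0" using l0 by simp
      fix l assume l: "l \<in> L" "norm (u + l) < norm (u + l0)"
      have "norm (l - l0) < e0"
        using norm_triangle_ineq4[of "u + l" "u + l0"] l l0 by (simp add: algebra_simps)
      then have "l = l0" using e0(2)[of "l - l0"] lattice_diff[OF assms l(1) l0(1)] by simp
      then show "u + l = 0" using l(2) by simp
    qed
  next
    case False
    then show ?thesis using e0(1) by (intro that[of "e0 / 2"]) auto
  qed
qed

locale lattice_torus =
  fixes L :: "(complex ^ 'n) set"
  assumes is_lattice: "is_lattice L"
begin

abbreviation "t \<equiv> torus_proj L"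
abbreviation "lin \<equiv> linear_lift L"

lemmas t_mult = torus_proj_mult[OF is_lattice]
lemmas t_eq_iff = torus_proj_eq_iff[OF is_lattice]
lemmas t_inv = torus_inv[OF is_lattice]

sublocale torus: flat_quotient "{\<lambda>v. v + l | l. l \<in> L}" "torus_proj L" L
proof
  show "id \<in> {\<lambda>v. v + l | l. l \<in> L}"
    using lattice_zero[OF is_lattice] by (intro CollectI exI[of _ 0]) auto
next
  fix \<gamma> \<delta> assume "\<gamma> \<in> {\<lambda>v. v + l | l. l \<in> L}" "\<delta> \<in> {\<lambda>v. v + l | l. l \<in> L}"
  then obtain l m where "l \<in> L" "m \<in> L" "\<gamma> = (\<lambda>v. v + l)" "\<delta> = (\<lambda>v. v + m)" by blast
  then show "\<gamma> \<circ> \<delta> \<in> {\<lambda>v. v + l | l. l \<in> L}"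
    using lattice_add[OF is_lattice, of m l]
    by (intro CollectI exI[of _ "m + l"]) (auto simp: add.assoc)
next
  fix \<gamma> assume "\<gamma> \<in> {\<lambda>v. v + l | l. l \<in> L}"
  then obtain l where l: "l \<in> L" "\<gamma> = (\<lambda>v. v + l)" by blast
  then have "(\<lambda>v. v + - l) \<in> {\<lambda>v. v + l | l. l \<in> L}"
    using lattice_uminus[OF is_lattice] by blast
  then show "\<exists>\<delta>\<in>{\<lambda>v. v + l | l. l \<in> L}. \<delta> \<circ> \<gamma> = id"
    by (rule bexI[rotated]) (auto simp: l)
  show "continuous_on UNIV \<gamma>" unfolding l(2) by (intro continuous_intros)
  show "complex_affine \<gamma>" unfolding l(2) by (rule complex_affine_translation)
next
  fix w :: "complex ^ 'n"
  obtain e where e: "e > 0" "\<And>l. l \<in> L \<Longrightarrow> norm l < e \<Longrightarrow> l = 0"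
    using lattice_discrete[OF is_lattice] by blast
  show "\<exists>W. open W \<and> w \<in> W \<and> (\<forall>\<gamma>\<in>{\<lambda>v. v + l | l. l \<in> L}. \<gamma> ` W \<inter> W \<noteq> {} \<longrightarrow> \<gamma> = id)"
  proof (intro exI[of _ "ball w (e / 2)"] conjI ballI impI)
    fix \<gamma> :: "complex ^ 'n \<Rightarrow> complex ^ 'n"
    assume "\<gamma> \<in> {\<lambda>v. v + l | l. l \<in> L}" "\<gamma> ` ball w (e / 2) \<inter> ball w (e / 2) \<noteq> {}"
    then obtain l x where l: "l \<in> L" "\<gamma> = (\<lambda>v. v + l)" and "x \<in> ball w (e / 2)" "\<gamma> x \<in> ball w (e / 2)"
      by blast
    then have x: "dist w x < e / 2" "dist w (x + l) < e / 2" by simp_all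
    have "norm l = dist x (x + l)" by (simp add: dist_norm)
    also have "\<dots> < e" using x dist_triangle3[of x "x + l" w] by linarith
    finally show "\<gamma> = id" using e(2) l by auto
  qed (use e in auto)
next
  show "t v = t w \<longleftrightarrow> (\<exists>\<gamma>\<in>{\<lambda>v. v + l | l. l \<in> L}. w = \<gamma> v)" for v w
  proof -
    have "(\<exists>\<gamma>\<in>{\<lambda>v. v + l | l. l \<in> L}. w = \<gamma> v) \<longleftrightarrow> (\<exists>l\<in>L. w = v + l)" by auto
    also have "\<dots> \<longleftrightarrow> w - v \<in> L"
    proof
      assume "w - v \<in> L"
      then show "\<exists>l\<in>L. w = v + l" by (rule bexI[rotated]) simp
    qed auto
    finally show ?thesis by (simp only: t_eq_iff)
  qed
next
  show "is_lattice L" by (rule is_lattice)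
  show "(\<lambda>v. v + b) \<in> {\<lambda>v. v + l | l. l \<in> L} \<longleftrightarrow> b \<in> L" for b
    by (auto simp: fun_eq_iff)
  show "\<exists>N>0. \<forall>\<gamma>\<in>{\<lambda>v. v + l | l. l \<in> L}. \<exists>l\<in>L. \<gamma> ^^ N = (\<lambda>v. v + l)"
    by (rule exI[of _ 1]) auto
qed

definition linear_automorphism :: "(complex ^ 'n \<Rightarrow> complex ^ 'n) \<Rightarrow> bool"
  where "linear_automorphism A \<longleftrightarrow> clinear A \<and> bij A \<and> A ` L = L"

lemma linear_automorphism_lifts:
  assumes "linear_automorphism A" shows "A \<in> torus.lifts"
proof -
  have A: "clinear A" "bij A" "A ` L = L" using assms by (auto simp: linear_automorphism_def)
  have "A w - A v \<in> L \<longleftrightarrow> w - v \<in> L" for v w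
    using A inj_image_mem_iff[OF bij_is_inj[OF A(2)], of "w - v" L] by (simp add: clinear_diff)
  then show ?thesis
    using complex_affineI[OF A(1), of 0] A(2) by (simp add: torus.lifts_def t_eq_iff)
qed

text \<open>
  Two linear lifts of \<open>g\<close> differ by a fixed element of \<open>L\<close>, which is zero as both vanish at the origin.
\<close>

lemma linear_lift_eqI:
  assumes A: "clinear A" and eq: "\<And>v. g (t v) = t (A v)"
  shows "lin g = A"
  unfolding linear_lift_def
proof (rule the_equality)
  fix A' assume A': "clinear A' \<and> (\<forall>v. g (t v) = t (A' v))"
  have "t (A v) = t (A' v)" for v using A' eq by metis
  moreover have "continuous_on UNIV A" "continuous_on UNIV A'"
    using A A' by (auto intro: linear_continuous_on clinear_bounded_linear)
  ultimately obtain \<gamma> where \<gamma>: "\<gamma> \<in> {\<lambda>v. v + l | l. l \<in> L}" "A' = \<gamma> \<circ> A"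
    using torus.lift_unique[of A A'] by blast
  then obtain l where l: "A' = (\<lambda>v. A v + l)" by (auto simp: comp_def)
  have "A 0 = 0" "A' 0 = 0" using A A' clinear_zero by blast+
  then have "l = 0" using fun_cong[OF l, of 0] by simp
  then show "A' = A" using l by simp
qed (use A eq in blast)

lemma carrier_Aut0: "carrier (Aut0 L) = carrier (Aut t) \<inter> hom (torus L) (torus L)"
  by (simp add: Aut0_def Aut_def)

lemma mult_Aut0: "g \<otimes>\<^bsub>Aut0 L\<^esub> h = g \<otimes>\<^bsub>Aut t\<^esub> h" and one_Aut0: "\<one>\<^bsub>Aut0 L\<^esub> = \<one>\<^bsub>Aut t\<^esub>"
  by (simp_all add: Aut0_def)

lemma
  assumes "g \<in> carrier (Aut0 L)"
  shows lin_automorphism: "linear_automorphism (lin g)"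
    and lin_lift: "g (t v) = t (lin g v)"
    and descend_lin: "g = torus.descend (lin g)"
proof -
  obtain F where F: "F \<in> torus.lifts" "g = torus.descend F"
    using assms carrier_Aut0 by (blast elim: torus.Aut_lift)
  let ?A = "linear_part F"
  \<comment> \<open>A homomorphism fixes the origin of the torus, so \<open>F 0\<close> can be dropped from an affine lift \<open>F\<close>.\<close>
  have "g \<in> hom (torus L) (torus L)" using assms carrier_Aut0 by blast
  then have "g (t 0 \<otimes>\<^bsub>torus L\<^esub> t 0) = g (t 0) \<otimes>\<^bsub>torus L\<^esub> g (t 0)"
    by (rule hom_mult) (rule torus_proj_in_carrier)+
  then have "t (F 0) = t (F 0 + F 0)" by (simp add: t_mult F torus.descend_apply)
  then have F0: "F 0 \<in> L" by (simp add: t_eq_iff)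
  have A: "linear_automorphism ?A"
    unfolding linear_automorphism_def
    using clinear_linear_part bij_linear_part torus.liftsD[OF F(1)] torus.linear_part_lifts_lattice[OF F(1)]
    by blast
  have gA: "g (t v) = t (?A v)" for v
    using F0 lattice_uminus[OF is_lattice]
    by (simp add: F torus.descend_apply t_eq_iff linear_part_def)
  have lin: "lin g = ?A"
  proof (rule linear_lift_eqI)
    show "clinear ?A" using A by (simp add: linear_automorphism_def)
    show "g (t v) = t (?A v)" for v by (rule gA)
  qed
  show "linear_automorphism (lin g)" using A lin by simp
  show "g (t v) = t (lin g v)" for v using gA lin by simp
  show "g = torus.descend (lin g)"
    using assms gA linear_automorphism_lifts[OF A] unfolding lin carrier_Aut0
    by (intro torus.Aut_eqI) (auto simp: torus.descend_mem torus.descend_apply)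
qed

lemma lin_clinear: "g \<in> carrier (Aut0 L) \<Longrightarrow> clinear (lin g)"
  and lin_bij: "g \<in> carrier (Aut0 L) \<Longrightarrow> bij (lin g)"
  and lin_lattice: "g \<in> carrier (Aut0 L) \<Longrightarrow> lin g ` L = L"
  using lin_automorphism unfolding linear_automorphism_def by blast+

lemma lin_lattice_mem: "g \<in> carrier (Aut0 L) \<Longrightarrow> l \<in> L \<Longrightarrow> lin g l \<in> L"
  using lin_lattice by blast

lemma
  assumes "linear_automorphism A"
  shows descend_linear_automorphism: "torus.descend A \<in> carrier (Aut0 L)"
    and lin_descend: "lin (torus.descend A) = A"
proof -
  note AF = linear_automorphism_lifts[OF assms]
  have lin: "clinear A" using assms by (simp add: linear_automorphism_def)
  show "torus.descend A \<in> carrier (Aut0 L)"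
    unfolding carrier_Aut0 hom_def carrier_torus
    by (auto simp: torus.descend_mem AF torus.descend_apply t_mult clinear_add[OF lin])
  show "lin (torus.descend A) = A"
    by (rule linear_lift_eqI[OF lin]) (simp add: torus.descend_apply AF)
qed

lemma lin_inject: "g \<in> carrier (Aut0 L) \<Longrightarrow> h \<in> carrier (Aut0 L) \<Longrightarrow> lin g = lin h \<Longrightarrow> g = h"
  using descend_lin by metis

lemma linear_automorphism_comp:
  "linear_automorphism A \<Longrightarrow> linear_automorphism B \<Longrightarrow> linear_automorphism (A \<circ> B)"
  unfolding linear_automorphism_def by (metis bij_comp clinear_comp image_comp)

lemma
  assumes "g \<in> carrier (Aut0 L)" "h \<in> carrier (Aut0 L)"
  shows Aut0_closed: "g \<otimes>\<^bsub>Aut0 L\<^esub> h \<in> carrier (Aut0 L)"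
    and lin_mult: "lin (g \<otimes>\<^bsub>Aut0 L\<^esub> h) = lin g \<circ> lin h"
proof -
  note A = lin_automorphism[OF assms(1)] and B = lin_automorphism[OF assms(2)]
  have "g \<otimes>\<^bsub>Aut0 L\<^esub> h = torus.descend (lin g) \<otimes>\<^bsub>Aut t\<^esub> torus.descend (lin h)"
    using descend_lin assms mult_Aut0 by metis
  also have "\<dots> = torus.descend (lin g \<circ> lin h)"
    by (rule torus.descend_comp) (use A B linear_automorphism_lifts in blast)+
  finally have *: "g \<otimes>\<^bsub>Aut0 L\<^esub> h = torus.descend (lin g \<circ> lin h)" .
  show "g \<otimes>\<^bsub>Aut0 L\<^esub> h \<in> carrier (Aut0 L)" "lin (g \<otimes>\<^bsub>Aut0 L\<^esub> h) = lin g \<circ> lin h"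
    unfolding * using linear_automorphism_comp[OF A B]
    by (simp_all add: descend_linear_automorphism lin_descend)
qed

lemma linear_automorphism_id: "linear_automorphism id"
  using clinear_id by (simp add: linear_automorphism_def id_def[symmetric])

lemma one_Aut0_closed: "\<one>\<^bsub>Aut0 L\<^esub> \<in> carrier (Aut0 L)" and lin_one: "lin \<one>\<^bsub>Aut0 L\<^esub> = id"
  unfolding one_Aut0 torus.one_Aut
  using linear_automorphism_id by (simp_all add: descend_linear_automorphism lin_descend)

lemma group_Aut0: "Group.group (Aut0 L)"
proof (rule groupI)
  fix g h k assume ghk: "g \<in> carrier (Aut0 L)" "h \<in> carrier (Aut0 L)" "k \<in> carrier (Aut0 L)"
  show "g \<otimes>\<^bsub>Aut0 L\<^esub> h \<otimes>\<^bsub>Aut0 L\<^esub> k = g \<otimes>\<^bsub>Aut0 L\<^esub> (h \<otimes>\<^bsub>Aut0 L\<^esub> k)"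
    by (rule lin_inject) (simp_all add: Aut0_closed ghk lin_mult comp_assoc)
next
  fix g assume g: "g \<in> carrier (Aut0 L)"
  show "\<one>\<^bsub>Aut0 L\<^esub> \<otimes>\<^bsub>Aut0 L\<^esub> g = g"
    by (rule lin_inject) (simp_all add: Aut0_closed one_Aut0_closed g lin_mult lin_one)
  let ?B = "inv_into UNIV (lin g)"
  have "?B ` L = ?B ` (lin g ` L)" using lin_lattice[OF g] by simp
  also have "\<dots> = L" by (simp add: image_comp bij_is_inj[OF lin_bij[OF g]])
  finally have B: "linear_automorphism ?B"
    using clinear_inv[OF lin_clinear[OF g] lin_bij[OF g]] bij_imp_bij_inv[OF lin_bij[OF g]]
    by (simp add: linear_automorphism_def)
  show "\<exists>h\<in>carrier (Aut0 L). h \<otimes>\<^bsub>Aut0 L\<^esub> g = \<one>\<^bsub>Aut0 L\<^esub>"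
  proof
    show B': "torus.descend ?B \<in> carrier (Aut0 L)" using descend_linear_automorphism[OF B] .
    show "torus.descend ?B \<otimes>\<^bsub>Aut0 L\<^esub> g = \<one>\<^bsub>Aut0 L\<^esub>"
      by (rule lin_inject)
        (simp_all add: Aut0_closed B' g one_Aut0_closed lin_mult lin_one lin_descend[OF B] bij_is_inj lin_bij)
  qed
qed (simp_all add: Aut0_closed one_Aut0_closed)

end

section \<open>The group of a special cocycle\<close>

lemma nat_pow_zero: "x [^]\<^bsub>E\<^esub> (0::nat) = \<one>\<^bsub>E\<^esub>"
  and nat_pow_step: "x [^]\<^bsub>E\<^esub> Suc n = x [^]\<^bsub>E\<^esub> n \<otimes>\<^bsub>E\<^esub> x"
  by (simp_all add: nat_pow_def)

text \<open>
  The function \<open>s\<close> is a lift of the cocycle \<open>z\<close> to the vector space. Of the condition that the class is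
  special, only the consequence for this one pair \<open>z\<close>, \<open>s\<close> is recorded.
\<close>

locale special_cocycle = lattice_torus L for L :: "(complex ^ 'n) set" +
  fixes G :: "'n torus_map set" and z :: "'n torus_map \<Rightarrow> (complex ^ 'n) set"
    and s :: "'n torus_map \<Rightarrow> complex ^ 'n"
  assumes subgroup_G: "subgroup G (Aut0 L)" and finite_G: "finite G"
    and cocycle: "z \<in> cocycles L G"
    and s: "g \<in> G \<Longrightarrow> torus_proj L (s g) = z g"
    and torsion_free: "torsion_free (extension_group L G (connecting L s))"
begin

sublocale Aut0: Group.group "Aut0 L" by (rule group_Aut0)

lemma G_Aut0: "g \<in> G \<Longrightarrow> g \<in> carrier (Aut0 L)"
  using subgroup.mem_carrier[OF subgroup_G] .

lemmas G_mult = subgroup.m_closed[OF subgroup_G]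
  and G_one = subgroup.one_closed[OF subgroup_G]
  and G_inv = subgroup.m_inv_closed[OF subgroup_G]

abbreviation "c \<equiv> connecting L s"

lemma connecting_in_L:
  assumes "g \<in> G" "h \<in> G" shows "c g h \<in> L"
proof -
  have "t (s (g \<otimes>\<^bsub>Aut0 L\<^esub> h)) = t (s g) \<otimes>\<^bsub>torus L\<^esub> g (t (s h))"
    using cocycle assms by (simp add: cocycles_def s G_mult)
  also have "\<dots> = t (s g + lin g (s h))"
    using lin_lift[OF G_Aut0[OF assms(1)]] by (simp add: t_mult)
  finally show ?thesis by (simp add: t_eq_iff connecting_def)
qed

lemma connecting_one: "c \<one>\<^bsub>Aut0 L\<^esub> \<one>\<^bsub>Aut0 L\<^esub> = s \<one>\<^bsub>Aut0 L\<^esub>"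
  by (simp add: connecting_def lin_one)

lemma s_one: "s \<one>\<^bsub>Aut0 L\<^esub> \<in> L"
  using connecting_in_L[OF G_one G_one] connecting_one by simp

definition deck :: "'n torus_map \<Rightarrow> complex ^ 'n \<Rightarrow> complex ^ 'n \<Rightarrow> complex ^ 'n"
  where "deck g l = (\<lambda>v. lin g v + (s g + l))"

text \<open>
  The group of all lifts to the vector space of the maps \<open>x \<mapsto> g x + z g\<close> of the torus. By \<open>deck_comp\<close> and
  \<open>pow_extension\<close> the map \<open>(l, g) \<mapsto> deck g l\<close> is a representation of the extension of \<open>G\<close> by \<open>L\<close> that
  \<open>connecting L s\<close> defines; this is how torsion-freeness of that extension becomes a statement about fixed points.
\<close>

definition deck_group :: "(complex ^ 'n \<Rightarrow> complex ^ 'n) set"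
  where "deck_group = {deck g l | g l. g \<in> G \<and> l \<in> L}"

lemma deck_mem: "g \<in> G \<Longrightarrow> l \<in> L \<Longrightarrow> deck g l \<in> deck_group"
  by (auto simp: deck_group_def)

lemma complex_affine_deck: "g \<in> G \<Longrightarrow> complex_affine (deck g l)"
  and linear_part_deck: "g \<in> G \<Longrightarrow> linear_part (deck g l) = lin g"
  unfolding deck_def by (simp_all add: complex_affineI linear_part_affine lin_clinear G_Aut0)

lemma deck_comp:
  assumes "g \<in> G" "h \<in> G"
  shows "deck g l \<circ> deck h m = deck (g \<otimes>\<^bsub>Aut0 L\<^esub> h) (l + lin g m + c g h)"
  using assms
  by (auto simp: deck_def fun_eq_iff connecting_def lin_mult G_Aut0 clinear_add[OF lin_clinear] algebra_simps)

lemma deck_one: "deck \<one>\<^bsub>Aut0 L\<^esub> l = (\<lambda>v. v + (s \<one>\<^bsub>Aut0 L\<^esub> + l))"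
  by (simp add: deck_def lin_one)

abbreviation "E \<equiv> extension_group L G c"

lemma mult_extension: "(l, g) \<otimes>\<^bsub>E\<^esub> (m, h) = (l + lin g m + c g h, g \<otimes>\<^bsub>Aut0 L\<^esub> h)"
  by (simp add: extension_group_def)

lemma pow_extension:
  assumes "g \<in> G" "l \<in> L"
  shows "deck g l ^^ n = deck (snd ((l, g) [^]\<^bsub>E\<^esub> n)) (fst ((l, g) [^]\<^bsub>E\<^esub> n))
    \<and> snd ((l, g) [^]\<^bsub>E\<^esub> n) = g [^]\<^bsub>Aut0 L\<^esub> n \<and> snd ((l, g) [^]\<^bsub>E\<^esub> n) \<in> G \<and> fst ((l, g) [^]\<^bsub>E\<^esub> n) \<in> L"
proof (induction n)
  case 0
  have "deck \<one>\<^bsub>Aut0 L\<^esub> (- s \<one>\<^bsub>Aut0 L\<^esub>) = id" by (auto simp: deck_one)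
  then show ?case
    using lattice_uminus[OF is_lattice s_one]
    by (simp add: nat_pow_zero extension_group_def connecting_one G_one)
next
  case (Suc n)
  obtain m h where mh: "(l, g) [^]\<^bsub>E\<^esub> n = (m, h)" by fastforce
  have IH: "deck g l ^^ n = deck h m" "h = g [^]\<^bsub>Aut0 L\<^esub> n" "h \<in> G" "m \<in> L"
    using Suc.IH mh by auto
  have "(l, g) [^]\<^bsub>E\<^esub> Suc n = (m + lin h l + c h g, h \<otimes>\<^bsub>Aut0 L\<^esub> g)"
    by (simp add: nat_pow_step mh mult_extension)
  moreover have "deck g l ^^ Suc n = deck h m \<circ> deck g l"
    by (simp only: funpow_Suc_right IH(1))
  moreover have "m + lin h l + c h g \<in> L"
    by (intro lattice_add[OF is_lattice] lin_lattice_mem[OF G_Aut0] connecting_in_L IH assms)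
  ultimately show ?case
    using deck_comp IH assms G_mult by (simp add: nat_pow_step)
qed

lemma pow_card_G:
  assumes "g \<in> G" shows "g [^]\<^bsub>Aut0 L\<^esub> card G = \<one>\<^bsub>Aut0 L\<^esub>"
proof -
  interpret G: Group.group "Aut0 L\<lparr>carrier := G\<rparr>"
    using subgroup.subgroup_is_group[OF subgroup_G group_Aut0] .
  have "g [^]\<^bsub>Aut0 L\<lparr>carrier := G\<rparr>\<^esub> order (Aut0 L\<lparr>carrier := G\<rparr>) = \<one>\<^bsub>Aut0 L\<^esub>"
    using G.pow_order_eq_1 assms by simp
  then show ?thesis by (simp add: order_def Aut0.nat_pow_consistent[symmetric])
qed

lemma card_G_pos: "card G > 0"
  using finite_G G_one card_gt_0_iff by blast

text \<open>
  If \<open>deck g l\<close> fixes \<open>w\<close>, so does its power with exponent \<open>card G\<close>. That power is a translation, hence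
  trivial, so \<open>(l, g)\<close> is a torsion element of the extension and therefore neutral.
\<close>

lemma deck_free:
  assumes "g \<in> G" "l \<in> L" "deck g l w = w"
  shows "deck g l = id"
proof -
  let ?x = "(l, g) [^]\<^bsub>E\<^esub> card G"
  have pow: "deck g l ^^ card G = deck (snd ?x) (fst ?x)" "snd ?x = \<one>\<^bsub>Aut0 L\<^esub>"
    using pow_extension[OF assms(1,2)] pow_card_G[OF assms(1)] by metis+
  have fixed: "(deck g l ^^ n) w = w" for n using assms(3) by (induction n) auto
  from fixed[of "card G"] have "w + (s \<one>\<^bsub>Aut0 L\<^esub> + fst ?x) = w"
    unfolding pow pow(2) deck_one .
  then have "fst ?x = - s \<one>\<^bsub>Aut0 L\<^esub>" by (simp add: eq_neg_iff_add_eq_0 add.commute)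
  then have "?x = \<one>\<^bsub>E\<^esub>"
    using pow(2) by (simp add: extension_group_def connecting_one prod_eq_iff)
  moreover have "(l, g) \<in> carrier E" using assms by (simp add: extension_group_def)
  ultimately have "(l, g) = \<one>\<^bsub>E\<^esub>" using torsion_free card_G_pos unfolding torsion_free_def by blast
  then have "g = \<one>\<^bsub>Aut0 L\<^esub>" "l = - s \<one>\<^bsub>Aut0 L\<^esub>"
    by (simp_all add: extension_group_def connecting_one)
  then show ?thesis by (auto simp: deck_one)
qed

text \<open>
  For fixed \<open>g\<close> the displacements \<open>deck g l w - w\<close> form a coset of \<open>L\<close>, which contains no short vectors
  other than zero; by freeness zero occurs only for the identity. As \<open>G\<close> is finite, one bound \<open>d\<close>
  works for all \<open>g\<close>, and on a small neighbourhood of \<open>w\<close> displacements change by less than \<open>d\<close>.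
\<close>

lemma deck_wandering:
  "\<exists>W. open W \<and> w \<in> W \<and> (\<forall>\<gamma>\<in>deck_group. \<gamma> ` W \<inter> W \<noteq> {} \<longrightarrow> \<gamma> = id)"
proof -
  have "\<exists>e>0. \<forall>l\<in>L. norm (deck g l w - w) < e \<longrightarrow> deck g l w = w" for g
  proof -
    obtain e where "e > 0" "\<And>l. l \<in> L \<Longrightarrow> norm ((lin g w + s g - w) + l) < e \<Longrightarrow> (lin g w + s g - w) + l = 0"
      using lattice_coset_discrete[OF is_lattice] by blast
    moreover have "(lin g w + s g - w) + l = deck g l w - w" for l by (simp add: deck_def)
    ultimately show ?thesis by auto
  qed
  then obtain e where e: "\<And>g. e g > 0"
    "\<And>g l. l \<in> L \<Longrightarrow> norm (deck g l w - w) < e g \<Longrightarrow> deck g l w = w"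
    by metis
  define d where "d = Min (e ` G)"
  have "d \<in> e ` G" unfolding d_def using finite_G G_one by (intro Min_in) auto
  then have "d > 0" using e(1) by auto
  moreover have "d \<le> e g" if "g \<in> G" for g unfolding d_def using finite_G that by (intro Min_le) auto
  ultimately have d: "d > 0" "\<And>g. g \<in> G \<Longrightarrow> d \<le> e g" by blast+
  have near: "\<forall>\<^sub>F x in nhds w. \<forall>g\<in>G. norm (lin g x - lin g w) < d / 2"
  proof (rule eventually_ball_finite[OF finite_G], rule ballI)
    fix g assume "g \<in> G"
    then have "isCont (lin g) w"
      using clinear_bounded_linear[OF lin_clinear[OF G_Aut0]] linear_continuous_at by blast
    then have "\<forall>\<^sub>F x in nhds w. dist (lin g x) (lin g w) < d / 2"
      using d(1) by (intro tendstoD) (auto simp: isCont_def tendsto_nhds_iff simp flip: filterlim_at_within_not_equal)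
    then show "\<forall>\<^sub>F x in nhds w. norm (lin g x - lin g w) < d / 2" by (simp add: dist_norm)
  qed
  have "\<forall>\<^sub>F x in nhds w. dist x w < d / 2"
    using d(1) by (intro tendstoD) (auto simp: filterlim_ident)
  with near obtain W where W: "open W" "w \<in> W"
    "\<And>x g. x \<in> W \<Longrightarrow> g \<in> G \<Longrightarrow> norm (lin g x - lin g w) < d / 2" "\<And>x. x \<in> W \<Longrightarrow> norm (x - w) < d / 2"
    unfolding eventually_nhds dist_norm by (metis IntD1 IntD2 IntI open_Int)
  have "\<gamma> = id" if \<gamma>: "\<gamma> \<in> deck_group" "\<gamma> ` W \<inter> W \<noteq> {}" for \<gamma>
  proof -
    obtain g l where gl: "g \<in> G" "l \<in> L" "\<gamma> = deck g l" using \<gamma>(1) by (auto simp: deck_group_def)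
    obtain x where x: "x \<in> W" "\<gamma> x \<in> W" using \<gamma>(2) by blast
    have "deck g l w - w = (deck g l x - w) - (lin g x - lin g w)" by (simp add: deck_def)
    then have "norm (deck g l w - w) \<le> norm (deck g l x - w) + norm (lin g x - lin g w)"
      by (metis norm_triangle_ineq4)
    also have "\<dots> < d / 2 + d / 2" using W(3)[OF x(1) gl(1)] W(4)[OF x(2)] gl(3) by (intro add_strict_mono) auto
    also have "\<dots> \<le> e g" using d(2)[OF gl(1)] by simp
    finally have "deck g l w = w" using e(2)[OF gl(2)] by blast
    then show ?thesis using deck_free gl by blast
  qed
  then show ?thesis using W(1,2) by blast
qed

abbreviation "q \<equiv> flat_proj L G z"

lemma flat_proj_eq: "q v = (\<lambda>\<gamma>. t (\<gamma> v)) ` deck_group"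
proof -
  let ?\<phi> = "\<lambda>g. \<lambda>x\<in>carrier (torus L). g x \<otimes>\<^bsub>torus L\<^esub> z g"
  have orbit: "{\<phi> x | \<phi>. \<phi> \<in> {f g | g. g \<in> G}} = (\<lambda>g. f g x) ` G"
    for f :: "'n torus_map \<Rightarrow> 'n torus_map" and x by blast
  have "q v = (\<lambda>g. ?\<phi> g (t v)) ` G"
    unfolding flat_proj_def orbit_def affine_group_def using orbit[of "t v" ?\<phi>] by simp
  also have "\<dots> = (\<lambda>g. t (lin g v + s g)) ` G"
    by (rule image_cong) (simp_all add: torus_proj_in_carrier s[symmetric] lin_lift G_Aut0 t_mult)
  also have "\<dots> = (\<lambda>\<gamma>. t (\<gamma> v)) ` deck_group"
  proof -
    have "t (deck g l v) = t (lin g v + s g)" if "l \<in> L" for g l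
      using that lattice_uminus[OF is_lattice] by (simp add: t_eq_iff deck_def)
    moreover have "deck_group = (\<Union>g\<in>G. deck g ` L)" by (auto simp: deck_group_def)
    moreover have "0 \<in> L" using lattice_zero[OF is_lattice] .
    ultimately show ?thesis by (auto simp: image_iff)
  qed
  finally show ?thesis .
qed

lemma deck_group_comp: "\<gamma> \<in> deck_group \<Longrightarrow> \<delta> \<in> deck_group \<Longrightarrow> \<gamma> \<circ> \<delta> \<in> deck_group"
proof -
  assume "\<gamma> \<in> deck_group" "\<delta> \<in> deck_group"
  then obtain g l h m where gl: "g \<in> G" "l \<in> L" "\<gamma> = deck g l" "h \<in> G" "m \<in> L" "\<delta> = deck h m"
    by (auto simp: deck_group_def)
  have "l + lin g m + c g h \<in> L"
    by (intro lattice_add[OF is_lattice] lin_lattice_mem[OF G_Aut0] connecting_in_L gl)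
  then show "\<gamma> \<circ> \<delta> \<in> deck_group" using gl deck_comp deck_mem G_mult by simp
qed

text \<open>
  An element of \<open>G\<close> is determined by its linear lift, so a translation in the group comes from the neutral
  element of \<open>G\<close>.
\<close>

lemma translation_deck: "(\<lambda>v. v + b) \<in> deck_group \<longleftrightarrow> b \<in> L"
proof
  assume "(\<lambda>v. v + b) \<in> deck_group"
  then obtain g l where gl: "g \<in> G" "l \<in> L" "(\<lambda>v. v + b) = deck g l" by (auto simp: deck_group_def)
  then have "lin g = id" using linear_part_deck linear_part_translation[of b] by (simp add: id_def)
  then have "g = \<one>\<^bsub>Aut0 L\<^esub>" using lin_inject lin_one G_Aut0 gl(1) one_Aut0_closed by metis
  then have "0 + b = 0 + (s \<one>\<^bsub>Aut0 L\<^esub> + l)" using gl(3) deck_one by metis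
  then show "b \<in> L" using lattice_add[OF is_lattice s_one gl(2)] by simp
next
  assume "b \<in> L"
  then have "deck \<one>\<^bsub>Aut0 L\<^esub> (b - s \<one>\<^bsub>Aut0 L\<^esub>) \<in> deck_group"
    by (intro deck_mem G_one lattice_diff[OF is_lattice] s_one)
  then show "(\<lambda>v. v + b) \<in> deck_group" by (simp add: deck_one)
qed

lemma deck_group_inverse:
  assumes "\<gamma> \<in> deck_group" shows "\<exists>\<delta>\<in>deck_group. \<delta> \<circ> \<gamma> = id"
proof -
  obtain g l where gl: "g \<in> G" "l \<in> L" "\<gamma> = deck g l" using assms by (auto simp: deck_group_def)
  let ?h = "inv\<^bsub>Aut0 L\<^esub> g"
  let ?m = "- s \<one>\<^bsub>Aut0 L\<^esub> - lin ?h l - c ?h g"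
  have "?m \<in> L"
    by (intro lattice_diff[OF is_lattice] lattice_uminus[OF is_lattice] s_one
        lin_lattice_mem[OF G_Aut0] connecting_in_L G_inv gl)
  then have "deck ?h ?m \<in> deck_group" using gl(1) G_inv deck_mem by blast
  moreover have "deck ?h ?m \<circ> \<gamma> = id"
    using gl G_inv by (auto simp: deck_comp G_Aut0 deck_one)
  ultimately show ?thesis by blast
qed

sublocale flat: flat_quotient deck_group "flat_proj L G z" L
proof
  show id: "id \<in> deck_group"
    using translation_deck[of 0] lattice_zero[OF is_lattice] by (simp add: id_def)
  show "complex_affine \<gamma>" if "\<gamma> \<in> deck_group" for \<gamma>
    using that complex_affine_deck by (auto simp: deck_group_def)
  then show "continuous_on UNIV \<gamma>" if "\<gamma> \<in> deck_group" for \<gamma>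
    using that complex_affine_continuous by blast
  show "q v = q w \<longleftrightarrow> (\<exists>\<gamma>\<in>deck_group. w = \<gamma> v)" for v w
  proof
    assume "q v = q w"
    moreover have "t w \<in> q w" unfolding flat_proj_eq using imageI[OF id, of "\<lambda>\<gamma>. t (\<gamma> w)"] by simp
    ultimately obtain \<gamma> where \<gamma>: "\<gamma> \<in> deck_group" "t w = t (\<gamma> v)" unfolding flat_proj_eq by blast
    then have "w - \<gamma> v \<in> L" using t_eq_iff by metis
    then have "(\<lambda>u. u + (w - \<gamma> v)) \<circ> \<gamma> \<in> deck_group"
      using \<gamma>(1) translation_deck deck_group_comp by blast
    then show "\<exists>\<gamma>\<in>deck_group. w = \<gamma> v" by (rule bexI[rotated]) simp
  next
    have sub: "q (\<gamma> v) \<subseteq> q v" if "\<gamma> \<in> deck_group" for \<gamma> v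
      unfolding flat_proj_eq using deck_group_comp[OF _ that] by (auto simp: image_iff) (metis comp_apply)
    assume "\<exists>\<gamma>\<in>deck_group. w = \<gamma> v"
    then obtain \<gamma> where \<gamma>: "\<gamma> \<in> deck_group" "w = \<gamma> v" by blast
    obtain \<delta> where \<delta>: "\<delta> \<in> deck_group" "\<delta> \<circ> \<gamma> = id" using deck_group_inverse \<gamma>(1) by blast
    then have v: "v = \<delta> w" using \<gamma>(2) by (metis comp_apply id_apply)
    show "q v = q w"
    proof
      show "q w \<subseteq> q v" unfolding \<gamma>(2) by (rule sub[OF \<gamma>(1)])
      show "q v \<subseteq> q w" using sub[OF \<delta>(1), of w] unfolding v[symmetric] .
    qed
  qed
  show "\<exists>N>0. \<forall>\<gamma>\<in>deck_group. \<exists>l\<in>L. \<gamma> ^^ N = (\<lambda>v. v + l)"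
  proof (intro exI[of _ "card G"] conjI card_G_pos ballI)
    fix \<gamma> assume "\<gamma> \<in> deck_group"
    then obtain g l where gl: "g \<in> G" "l \<in> L" "\<gamma> = deck g l" by (auto simp: deck_group_def)
    let ?x = "(l, g) [^]\<^bsub>E\<^esub> card G"
    have "\<gamma> ^^ card G = deck \<one>\<^bsub>Aut0 L\<^esub> (fst ?x)" "fst ?x \<in> L"
      using pow_extension[OF gl(1,2)] pow_card_G[OF gl(1)] gl(3) by metis+
    then show "\<exists>l\<in>L. \<gamma> ^^ card G = (\<lambda>v. v + l)"
      unfolding deck_one using lattice_add[OF is_lattice s_one] by blast
  qed
qed (use deck_group_comp deck_group_inverse deck_wandering translation_deck is_lattice in blast)+

end

section \<open>Which affine maps descend to the flat manifold\<close>

context special_cocycle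
begin

abbreviation conj_by :: "'n torus_map \<Rightarrow> 'n torus_map \<Rightarrow> 'n torus_map"
  where "conj_by n g \<equiv> n \<otimes>\<^bsub>Aut0 L\<^esub> g \<otimes>\<^bsub>Aut0 L\<^esub> inv\<^bsub>Aut0 L\<^esub> n"

lemma normalizer_iff:
  "n \<in> normalizer (Aut0 L) G \<longleftrightarrow> n \<in> carrier (Aut0 L) \<and> conj_by n ` G = G"
proof -
  have "n <#\<^bsub>Aut0 L\<^esub> G #>\<^bsub>Aut0 L\<^esub> inv\<^bsub>Aut0 L\<^esub> n = conj_by n ` G"
    by (auto simp: l_coset_def r_coset_def)
  then show ?thesis
    using subgroup.subset[OF subgroup_G] by (simp add: normalizer_def stabilizer_def)
qed

lemma conj_by_mult:
  assumes "n \<in> carrier (Aut0 L)" "g \<in> carrier (Aut0 L)"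
  shows "conj_by n g \<otimes>\<^bsub>Aut0 L\<^esub> n = n \<otimes>\<^bsub>Aut0 L\<^esub> g"
  using assms by (simp add: Aut0.m_assoc)

lemma conj_by_back:
  assumes "n \<in> carrier (Aut0 L)" "g \<in> carrier (Aut0 L)"
  shows "inv\<^bsub>Aut0 L\<^esub> n \<otimes>\<^bsub>Aut0 L\<^esub> conj_by n g \<otimes>\<^bsub>Aut0 L\<^esub> n = g"
  using assms by (simp add: Aut0.m_assoc Aut0.inv_solve_left')

lemma lin_conj_by:
  assumes "n \<in> carrier (Aut0 L)" "g \<in> carrier (Aut0 L)"
  shows "lin (conj_by n g) (lin n v) = lin n (lin g v)"
proof -
  have "lin (conj_by n g \<otimes>\<^bsub>Aut0 L\<^esub> n) = lin (conj_by n g) \<circ> lin n"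
    by (rule lin_mult) (use assms in simp_all)
  moreover have "lin (n \<otimes>\<^bsub>Aut0 L\<^esub> g) = lin n \<circ> lin g" by (rule lin_mult) (use assms in simp_all)
  ultimately show ?thesis using conj_by_mult[OF assms] by (metis comp_apply)
qed

text \<open>
  For \<open>F v = lin n v + b\<close>, conjugating \<open>deck g m\<close> by \<open>F\<close> gives an affine map with linear part
  \<open>lin (conj_by n g)\<close>. The defect measures how far its translation part is from the one that \<open>s\<close>
  prescribes, up to \<open>lin n m\<close>, which lies in \<open>L\<close> whenever \<open>m\<close> does.
\<close>

definition defect :: "'n torus_map \<Rightarrow> complex ^ 'n \<Rightarrow> 'n torus_map \<Rightarrow> complex ^ 'n"
  where "defect n b g = lin n (s g) + b - lin (conj_by n g) b - s (conj_by n g)"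

lemma conjugate_deck:
  assumes "n \<in> carrier (Aut0 L)" "g \<in> G" "conj_by n g \<in> G"
  shows "(\<lambda>v. lin n v + b) \<circ> deck g m = deck (conj_by n g) (lin n m + defect n b g) \<circ> (\<lambda>v. lin n v + b)"
  using assms clinear_add[OF lin_clinear[OF assms(1)]]
    clinear_add[OF lin_clinear[OF G_Aut0[OF assms(3)]]]
  by (simp add: fun_eq_iff deck_def defect_def lin_conj_by G_Aut0 algebra_simps)

text \<open>
  The map descends exactly if it conjugates the group \<open>deck_group\<close> onto itself. By \<open>conjugate_deck\<close> this
  asks on linear parts that \<open>n\<close> normalise \<open>G\<close>, and on translation parts that the defects lie in \<open>L\<close>.
\<close>

lemma affine_lifts_iff:
  assumes n: "n \<in> carrier (Aut0 L)"
  shows "(\<lambda>v. lin n v + b) \<in> flat.lifts \<longleftrightarrow>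
    n \<in> normalizer (Aut0 L) G \<and> (\<forall>g\<in>G. defect n b g \<in> L)"
proof
  let ?F = "\<lambda>v. lin n v + b"
  assume F: "?F \<in> flat.lifts"
  have linF: "linear_part ?F = lin n" by (rule linear_part_affine[OF lin_clinear[OF n]])
  have *: "conj_by n g \<in> G \<and> defect n b g \<in> L" if g: "g \<in> G" for g
  proof -
    obtain \<delta> where "\<delta> \<in> deck_group" "?F \<circ> deck g 0 = \<delta> \<circ> ?F"
      by (rule flat.lifts_conjugate[OF F deck_mem[OF g lattice_zero[OF is_lattice]]])
    then obtain a l where al: "a \<in> G" "l \<in> L" "?F \<circ> deck g 0 = deck a l \<circ> ?F"
      by (auto simp: deck_group_def)
    have "linear_part (?F \<circ> deck g 0) = lin n \<circ> lin g"
      unfolding linear_part_comp[OF flat.liftsD(1)[OF F]] linF linear_part_deck[OF g] ..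
    moreover have "linear_part (deck a l \<circ> ?F) = lin a \<circ> lin n"
      unfolding linear_part_comp[OF complex_affine_deck[OF al(1)]] linF linear_part_deck[OF al(1)] ..
    ultimately have "lin (n \<otimes>\<^bsub>Aut0 L\<^esub> g) = lin (a \<otimes>\<^bsub>Aut0 L\<^esub> n)"
      using al n g by (simp add: lin_mult G_Aut0)
    then have "n \<otimes>\<^bsub>Aut0 L\<^esub> g = a \<otimes>\<^bsub>Aut0 L\<^esub> n"
      by (rule lin_inject[rotated 2]) (use al n g G_Aut0 in simp_all)
    then have a: "conj_by n g = a" using al n g G_Aut0 by (simp add: Aut0.inv_solve_right' Aut0.m_assoc)
    then have "deck a (lin n 0 + defect n b g) \<circ> ?F = deck a l \<circ> ?F"
      using conjugate_deck[OF n g, of b 0] al by simp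
    then have "deck a (lin n 0 + defect n b g) (?F 0) = deck a l (?F 0)" by (metis comp_apply)
    then have "defect n b g = l" by (simp add: deck_def clinear_zero[OF lin_clinear[OF n]])
    then show ?thesis using a al by simp
  qed
  \<comment> \<open>Conjugation maps the finite set \<open>G\<close> injectively into itself, hence onto itself.\<close>
  have "inj_on (conj_by n) G"
    by (rule inj_on_inverseI[of _ "\<lambda>a. inv\<^bsub>Aut0 L\<^esub> n \<otimes>\<^bsub>Aut0 L\<^esub> a \<otimes>\<^bsub>Aut0 L\<^esub> n"]) (simp add: conj_by_back n G_Aut0)
  then have "conj_by n ` G = G" using * by (intro endo_inj_surj finite_G) auto
  then show "n \<in> normalizer (Aut0 L) G \<and> (\<forall>g\<in>G. defect n b g \<in> L)"
    using n * normalizer_iff by blast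
next
  let ?F = "\<lambda>v. lin n v + b"
  assume "n \<in> normalizer (Aut0 L) G \<and> (\<forall>g\<in>G. defect n b g \<in> L)"
  then have conj: "conj_by n ` G = G" and defect: "\<And>g. g \<in> G \<Longrightarrow> defect n b g \<in> L"
    using normalizer_iff by auto
  have conj_mem: "conj_by n g \<in> G" if "g \<in> G" for g using conj that by blast
  have "bij (\<lambda>v. v + b)" by (rule o_bij[of "\<lambda>v. v - b"]) auto
  then have "bij ((\<lambda>v. v + b) \<circ> lin n)" using lin_bij[OF n] bij_comp by blast
  then have bij: "bij ?F" by (simp add: comp_def)
  have "q (?F v) = q (?F w) \<longleftrightarrow> q v = q w" for v w
  proof
    assume "q v = q w"
    then obtain g m where gm: "g \<in> G" "m \<in> L" "w = deck g m v"
      using flat.fibre by (auto simp: deck_group_def)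
    then have "?F w = deck (conj_by n g) (lin n m + defect n b g) (?F v)"
      using fun_cong[OF conjugate_deck[OF n gm(1) conj_mem[OF gm(1)]]] by simp
    moreover have "lin n m + defect n b g \<in> L"
      using lattice_add[OF is_lattice lin_lattice_mem[OF n gm(2)] defect[OF gm(1)]] .
    ultimately show "q (?F v) = q (?F w)" using flat.fibre deck_mem[OF conj_mem[OF gm(1)]] by blast
  next
    assume "q (?F v) = q (?F w)"
    then obtain a m where am: "a \<in> G" "m \<in> L" "?F w = deck a m (?F v)"
      using flat.fibre by (auto simp: deck_group_def)
    obtain g where g: "g \<in> G" "a = conj_by n g" using conj am(1) by blast
    have "m - defect n b g \<in> lin n ` L"
      unfolding lin_lattice[OF n] using lattice_diff[OF is_lattice am(2) defect[OF g(1)]] .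
    then obtain m' where m': "m' \<in> L" "lin n m' = m - defect n b g" by force
    have "?F (deck g m' v) = deck a (lin n m' + defect n b g) (?F v)"
      using fun_cong[OF conjugate_deck[OF n g(1) conj_mem[OF g(1)]]] g(2) by simp
    then have "?F (deck g m' v) = ?F w" using m'(2) am(3) by simp
    then have "w = deck g m' v" using bij by (metis bij_is_inj injD)
    then show "q v = q w" using flat.fibre deck_mem[OF g(1) m'(1)] by blast
  qed
  then show "?F \<in> flat.lifts"
    using bij complex_affineI[OF lin_clinear[OF n]] by (simp add: flat.lifts_def)
qed

section \<open>The stabiliser of a cohomology class\<close>

text \<open>
  The sum of \<open>z\<close> and the coboundary of the point \<open>t u\<close>.
\<close>

definition translate_cocycle :: "complex ^ 'n \<Rightarrow> 'n torus_map \<Rightarrow> (complex ^ 'n) set"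
  where "translate_cocycle u = (\<lambda>g\<in>G. t (s g + (lin g u - u)))"

definition cocycle_class :: "('n torus_map \<Rightarrow> (complex ^ 'n) set) set"
  where "cocycle_class = range translate_cocycle"

text \<open>
  Evaluated at \<open>conj_by n g\<close>, the two cocycles differ by the image of \<open>defect n b g\<close> in the torus. So the
  condition that the affine map descends is a statement about the action of \<open>n\<close> on cocycles.
  The parameter \<open>u\<close> drops out since the action sends the coboundary of \<open>t u\<close> to that of \<open>t (lin n u)\<close>.
\<close>

lemma cocycle_action_eq_iff:
  assumes "n \<in> normalizer (Aut0 L) G"
  shows "cocycle_action L G n (translate_cocycle u) = translate_cocycle (lin n u + b)
    \<longleftrightarrow> (\<forall>g\<in>G. defect n b g \<in> L)"
proof -
  have n: "n \<in> carrier (Aut0 L)" and conj: "conj_by n ` G = G" using assms normalizer_iff by auto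
  have eq: "cocycle_action L G n (translate_cocycle u) (conj_by n g)
      = translate_cocycle (lin n u + b) (conj_by n g) \<longleftrightarrow> defect n b g \<in> L" if g: "g \<in> G" for g
  proof -
    have a: "conj_by n g \<in> G" using conj g by blast
    have "cocycle_action L G n (translate_cocycle u) (conj_by n g) = t (lin n (s g + (lin g u - u)))"
      using a g by (simp add: cocycle_action_def conj_by_back n G_Aut0 translate_cocycle_def lin_lift)
    moreover have "translate_cocycle (lin n u + b) (conj_by n g)
        = t (s (conj_by n g) + (lin (conj_by n g) (lin n u + b) - (lin n u + b)))"
      using a by (simp add: translate_cocycle_def)
    moreover have "lin n (s g + (lin g u - u)) -
        (s (conj_by n g) + (lin (conj_by n g) (lin n u + b) - (lin n u + b))) = defect n b g"
      using clinear_add[OF lin_clinear[OF n]] clinear_diff[OF lin_clinear[OF n]]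
        clinear_add[OF lin_clinear[OF G_Aut0[OF a]]]
      by (simp add: defect_def lin_conj_by n G_Aut0 g)
    ultimately show ?thesis by (metis t_eq_iff)
  qed
  have "cocycle_action L G n (translate_cocycle u) = translate_cocycle (lin n u + b) \<longleftrightarrow>
    (\<forall>a\<in>G. cocycle_action L G n (translate_cocycle u) a = translate_cocycle (lin n u + b) a)"
    by (auto simp: cocycle_action_def translate_cocycle_def fun_eq_iff restrict_def)
  also have "\<dots> \<longleftrightarrow> (\<forall>a\<in>conj_by n ` G. cocycle_action L G n (translate_cocycle u) a
      = translate_cocycle (lin n u + b) a)"
    unfolding conj ..
  also have "\<dots> \<longleftrightarrow> (\<forall>g\<in>G. defect n b g \<in> L)" using eq by (simp only: ball_simps(9) cong: ball_cong)
  finally show ?thesis .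
qed

lemma stabilizes_class_iff:
  assumes n: "n \<in> normalizer (Aut0 L) G"
  shows "cocycle_action L G n ` cocycle_class = cocycle_class \<longleftrightarrow> (\<exists>b. \<forall>g\<in>G. defect n b g \<in> L)"
proof
  have n': "n \<in> carrier (Aut0 L)" using n normalizer_iff by blast
  note surj = bij_is_surj[OF lin_bij[OF n']]
  {
    assume "cocycle_action L G n ` cocycle_class = cocycle_class"
    then have "cocycle_action L G n (translate_cocycle 0) \<in> range translate_cocycle"
      unfolding cocycle_class_def by blast
    then obtain b where "cocycle_action L G n (translate_cocycle 0) = translate_cocycle b" by blast
    moreover have "lin n 0 + b = b" using clinear_zero[OF lin_clinear[OF n']] by simp
    ultimately show "\<exists>b. \<forall>g\<in>G. defect n b g \<in> L"
      using cocycle_action_eq_iff[OF n, of 0 b] by (intro exI[of _ b]) simp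
  }
  assume "\<exists>b. \<forall>g\<in>G. defect n b g \<in> L"
  then obtain b where "\<forall>g\<in>G. defect n b g \<in> L" by blast
  then have "cocycle_action L G n (translate_cocycle u) = translate_cocycle (lin n u + b)" for u
    using cocycle_action_eq_iff[OF n] by blast
  then have "cocycle_action L G n ` cocycle_class = translate_cocycle ` range (\<lambda>u. lin n u + b)"
    unfolding cocycle_class_def image_image by simp
  also have "range (\<lambda>u. lin n u + b) = UNIV"
  proof -
    have "w \<in> range (\<lambda>u. lin n u + b)" for w
    proof -
      obtain u where "w - b = lin n u" using surj by (metis surjD)
      then show ?thesis by (intro range_eqI[of _ _ u]) (simp add: diff_eq_eq)
    qed
    then show ?thesis by blast
  qed
  finally show "cocycle_action L G n ` cocycle_class = cocycle_class" by (simp add: cocycle_class_def)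
qed

abbreviation "S \<equiv> class_stabilizer L G cocycle_class"

text \<open>
  The key identification: the stabiliser of the class consists of the linear parts of those affine maps that
  descend to the flat manifold, the translation part \<open>b\<close> representing a point whose
  coboundary is the difference between the cocycle and its image. That it is a group, and that it contains \<open>G\<close> as a normal subgroup, is then inherited from the lifts.
\<close>

lemma carrier_stabilizer:
  "carrier S = {n \<in> carrier (Aut0 L). \<exists>b. (\<lambda>v. lin n v + b) \<in> flat.lifts}"
proof -
  have "carrier S = {n \<in> normalizer (Aut0 L) G. cocycle_action L G n ` cocycle_class = cocycle_class}"
    by (simp add: class_stabilizer_def stabilizer_def)
  also have "\<dots> = {n \<in> normalizer (Aut0 L) G. \<exists>b. \<forall>g\<in>G. defect n b g \<in> L}"
    by (intro Collect_cong conj_cong refl stabilizes_class_iff)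
  also have "\<dots> = {n \<in> carrier (Aut0 L). \<exists>b. (\<lambda>v. lin n v + b) \<in> flat.lifts}"
  proof (rule Collect_cong)
    fix n
    show "n \<in> normalizer (Aut0 L) G \<and> (\<exists>b. \<forall>g\<in>G. defect n b g \<in> L) \<longleftrightarrow>
        n \<in> carrier (Aut0 L) \<and> (\<exists>b. (\<lambda>v. lin n v + b) \<in> flat.lifts)"
      using affine_lifts_iff[of n] normalizer_iff[of n] by blast
  qed
  finally show ?thesis .
qed

lemma stabilizer_normalizes: "n \<in> carrier S \<Longrightarrow> g \<in> G \<Longrightarrow> conj_by n g \<in> G"
  using carrier_stabilizer affine_lifts_iff normalizer_iff by blast

lemma mult_S: "n \<otimes>\<^bsub>S\<^esub> m = n \<otimes>\<^bsub>Aut0 L\<^esub> m"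
  and S_eq: "Aut0 L\<lparr>carrier := carrier S\<rparr> = S"
  by (simp_all add: class_stabilizer_def)

definition linearize :: "(complex ^ 'n \<Rightarrow> complex ^ 'n) \<Rightarrow> 'n torus_map"
  where "linearize F = torus.descend (linear_part F)"

lemma
  assumes "F \<in> flat.lifts"
  shows linearize_Aut0: "linearize F \<in> carrier (Aut0 L)"
    and lin_linearize: "lin (linearize F) = linear_part F"
    and linearize_S: "linearize F \<in> carrier S"
proof -
  have "linear_automorphism (linear_part F)"
    unfolding linear_automorphism_def
    using clinear_linear_part bij_linear_part flat.liftsD[OF assms] flat.linear_part_lifts_lattice[OF assms]
    by blast
  then show n: "linearize F \<in> carrier (Aut0 L)" and lin: "lin (linearize F) = linear_part F"
    unfolding linearize_def by (rule descend_linear_automorphism, rule lin_descend)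
  have "(\<lambda>v. lin (linearize F) v + F 0) = F" by (simp add: lin linear_part_def)
  then have "(\<lambda>v. lin (linearize F) v + F 0) \<in> flat.lifts" using assms by simp
  then show "linearize F \<in> carrier S" using n unfolding carrier_stabilizer by blast
qed

lemma linearize_eqI: "n \<in> carrier (Aut0 L) \<Longrightarrow> F \<in> flat.lifts \<Longrightarrow> linear_part F = lin n \<Longrightarrow> linearize F = n"
  by (simp add: lin_inject linearize_Aut0 lin_linearize)

lemma S_linearize:
  assumes "n \<in> carrier S"
  obtains F where "F \<in> flat.lifts" "n = linearize F"
proof -
  obtain b where n: "n \<in> carrier (Aut0 L)" and b: "(\<lambda>v. lin n v + b) \<in> flat.lifts"
    using assms carrier_stabilizer by blast
  then have "n = linearize (\<lambda>v. lin n v + b)"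
    using linearize_eqI linear_part_affine[OF lin_clinear[OF n]] by metis
  then show ?thesis using that b by blast
qed

lemma linearize_comp:
  assumes "F \<in> flat.lifts" "H \<in> flat.lifts"
  shows "linearize (F \<circ> H) = linearize F \<otimes>\<^bsub>Aut0 L\<^esub> linearize H"
  using assms
  by (intro linearize_eqI)
    (simp_all add: flat.lifts_comp lin_mult linearize_Aut0 lin_linearize linear_part_comp flat.liftsD)

lemma linearize_deck: "g \<in> G \<Longrightarrow> l \<in> L \<Longrightarrow> linearize (deck g l) = g"
  by (intro linearize_eqI) (simp_all add: G_Aut0 linear_part_deck flat.deck_lifts deck_mem)

lemma linearize_id: "linearize id = \<one>\<^bsub>Aut0 L\<^esub>"
  by (intro linearize_eqI) (simp_all add: flat.id_lifts lin_one linear_part_def fun_eq_iff)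

lemma subgroup_S: "subgroup (carrier S) (Aut0 L)"
proof (rule Aut0.subgroupI)
  show "carrier S \<subseteq> carrier (Aut0 L)" using carrier_stabilizer by blast
  show "carrier S \<noteq> {}" using linearize_S flat.id_lifts by blast
  fix n assume "n \<in> carrier S"
  then obtain F where F: "F \<in> flat.lifts" "n = linearize F" by (rule S_linearize)
  have "linearize (inv_into UNIV F) \<otimes>\<^bsub>Aut0 L\<^esub> n = \<one>\<^bsub>Aut0 L\<^esub>"
    using F by (simp add: linearize_comp[symmetric] flat.lifts_inv flat.lifts_inv_comp linearize_id)
  then have "inv\<^bsub>Aut0 L\<^esub> n = linearize (inv_into UNIV F)"
    using F by (intro Aut0.inv_equality) (simp_all add: linearize_Aut0 flat.lifts_inv)
  then show "inv\<^bsub>Aut0 L\<^esub> n \<in> carrier S" using F linearize_S flat.lifts_inv by simp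
  fix m assume "m \<in> carrier S"
  then obtain H where H: "H \<in> flat.lifts" "m = linearize H" by (rule S_linearize)
  show "n \<otimes>\<^bsub>Aut0 L\<^esub> m \<in> carrier S"
    using F H linearize_S[OF flat.lifts_comp] by (simp add: linearize_comp)
qed

lemma group_S: "Group.group S"
  using subgroup.subgroup_is_group[OF subgroup_S group_Aut0] S_eq by simp

lemma normal_G: "G \<lhd> S"
proof -
  have "G \<subseteq> carrier S"
    using linearize_deck linearize_S flat.deck_lifts deck_mem lattice_zero[OF is_lattice] by (metis subsetI)
  then have "subgroup G S"
    using Aut0.subgroup_incl[OF subgroup_G subgroup_S] S_eq by simp
  moreover have "n \<otimes>\<^bsub>S\<^esub> g \<otimes>\<^bsub>S\<^esub> inv\<^bsub>S\<^esub> n \<in> G" if "n \<in> carrier S" "g \<in> G" for n g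
    using stabilizer_normalizes[OF that] Aut0.m_inv_consistent[OF subgroup_S that(1)]
    by (simp add: mult_S S_eq)
  ultimately show ?thesis using group.normal_inv_iff[OF group_S] by blast
qed

section \<open>The extension\<close>

text \<open>
  The lifts of \<open>f\<close> differ by elements of \<open>deck_group\<close>, so their linear parts fill exactly one coset of \<open>G\<close>;
  collecting all of them makes the map to the quotient well defined without choosing a lift.
\<close>

definition linear_coset :: "((complex ^ 'n) set set \<Rightarrow> (complex ^ 'n) set set) \<Rightarrow> 'n torus_map set"
  where "linear_coset f =
    {n \<in> carrier (Aut0 L). \<exists>F\<in>flat.lifts. f = flat.descend F \<and> linear_part F = lin n}"

lemma linear_coset_descend:
  assumes F: "F \<in> flat.lifts"
  shows "linear_coset (flat.descend F) = G #>\<^bsub>S\<^esub> linearize F"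
proof
  show "linear_coset (flat.descend F) \<subseteq> G #>\<^bsub>S\<^esub> linearize F"
  proof
    fix n assume "n \<in> linear_coset (flat.descend F)"
    then obtain H where n: "n \<in> carrier (Aut0 L)" and H: "H \<in> flat.lifts" "linear_part H = lin n"
      and eq: "flat.descend F = flat.descend H"
      unfolding linear_coset_def by blast
    then obtain g l where gl: "g \<in> G" "l \<in> L" "H = deck g l \<circ> F"
      using flat.descend_eq_iff[OF F H(1)] by (auto simp: deck_group_def)
    have "n = linearize H" using linearize_eqI n H by simp
    also have "\<dots> = g \<otimes>\<^bsub>Aut0 L\<^esub> linearize F"
      using gl F by (simp add: linearize_comp flat.deck_lifts deck_mem linearize_deck)
    finally show "n \<in> G #>\<^bsub>S\<^esub> linearize F" using gl(1) by (auto simp: r_coset_def mult_S)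
  qed
  show "G #>\<^bsub>S\<^esub> linearize F \<subseteq> linear_coset (flat.descend F)"
  proof
    fix n assume "n \<in> G #>\<^bsub>S\<^esub> linearize F"
    then obtain g where g: "g \<in> G" "n = g \<otimes>\<^bsub>Aut0 L\<^esub> linearize F" by (auto simp: r_coset_def mult_S)
    have deck: "deck g 0 \<in> deck_group" using deck_mem g(1) lattice_zero[OF is_lattice] .
    let ?H = "deck g 0 \<circ> F"
    have H: "?H \<in> flat.lifts" using flat.lifts_comp flat.deck_lifts deck F by blast
    have "n = linearize ?H"
      using g F by (simp add: linearize_comp flat.deck_lifts deck linearize_deck lattice_zero[OF is_lattice])
    moreover have "flat.descend F = flat.descend ?H" using flat.descend_eq_iff[OF F H] deck by blast
    ultimately show "n \<in> linear_coset (flat.descend F)"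
      unfolding linear_coset_def using H linearize_Aut0 lin_linearize by auto
  qed
qed

text \<open>
  The case \<open>n = 1\<close> of \<open>affine_lifts_iff\<close>: the defect is \<open>b - lin g b\<close>.
\<close>

lemma translation_lifts_iff: "(\<lambda>v. v + b) \<in> flat.lifts \<longleftrightarrow> (\<forall>g\<in>G. g (t b) = t b)"
proof -
  have conj: "conj_by \<one>\<^bsub>Aut0 L\<^esub> g = g" if "g \<in> G" for g
    using G_Aut0[OF that] by simp
  then have "\<one>\<^bsub>Aut0 L\<^esub> \<in> normalizer (Aut0 L) G" using normalizer_iff by simp
  then have "(\<lambda>v. v + b) \<in> flat.lifts \<longleftrightarrow> (\<forall>g\<in>G. defect \<one>\<^bsub>Aut0 L\<^esub> b g \<in> L)"
    using affine_lifts_iff[OF one_Aut0_closed, of b] by (simp add: lin_one)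
  also have "\<dots> \<longleftrightarrow> (\<forall>g\<in>G. b - lin g b \<in> L)"
    by (rule ball_cong) (simp_all only: defect_def conj lin_one id_apply, simp)
  also have "\<dots> \<longleftrightarrow> (\<forall>g\<in>G. g (t b) = t b)"
    by (rule ball_cong) (simp_all add: lin_lift G_Aut0 t_eq_iff)
  finally show ?thesis .
qed

text \<open>
  The choice of \<open>b\<close> does not matter, by \<open>translation_map_eq\<close>: translations by elements of \<open>L\<close> act trivially on the flat manifold.
\<close>

definition translation_map :: "(complex ^ 'n) set \<Rightarrow> (complex ^ 'n) set set \<Rightarrow> (complex ^ 'n) set set"
  where "translation_map x = flat.descend (\<lambda>v. v + (SOME b. t b = x))"

abbreviation "TG \<equiv> fixed_points L G"

lemma fixed_pointsE:
  assumes "x \<in> carrier TG"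
  obtains b where "x = t b" "(\<lambda>v. v + b) \<in> flat.lifts"
  using assms translation_lifts_iff by (auto simp: fixed_points_def carrier_torus)

lemma translation_map_eq:
  assumes "(\<lambda>v. v + b) \<in> flat.lifts"
  shows "translation_map (t b) = flat.descend (\<lambda>v. v + b)"
proof -
  define b' where "b' = (SOME b'. t b' = t b)"
  have "t b' = t b" unfolding b'_def by (rule someI) (rule refl)
  then have "(\<lambda>v. v + b') \<in> flat.lifts" using assms translation_lifts_iff by simp
  moreover have "b' - b \<in> L" using \<open>t b' = t b\<close>[symmetric] t_eq_iff by blast
  moreover have "(\<lambda>v. v + b') = (\<lambda>v. v + (b' - b)) \<circ> (\<lambda>v. v + b)" by auto
  ultimately have "flat.descend (\<lambda>v. v + b) = flat.descend (\<lambda>v. v + b')"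
    using flat.descend_eq_iff[OF assms] translation_deck by blast
  then show ?thesis by (simp add: translation_map_def b'_def)
qed

lemma group_fixed_points: "Group.group TG"
proof -
  interpret T: comm_group "torus L" using comm_group_torus[OF is_lattice] .
  have "subgroup {x \<in> carrier (torus L). \<forall>g\<in>G. g x = x} (torus L)"
  proof (rule T.subgroupI)
    have "g (t 0) = t 0" if "g \<in> G" for g
      using G_Aut0[OF that] by (simp add: lin_lift clinear_zero[OF lin_clinear])
    then show "{x \<in> carrier (torus L). \<forall>g\<in>G. g x = x} \<noteq> {}" using torus_proj_in_carrier by blast
    fix x assume "x \<in> {x \<in> carrier (torus L). \<forall>g\<in>G. g x = x}"
    then obtain v where v: "x = t v" "\<And>g. g \<in> G \<Longrightarrow> t (lin g v) = t v"
      by (auto simp: carrier_torus lin_lift G_Aut0)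
    have "t (lin g (- v)) = t (- v)" if "g \<in> G" for g
      using v(2)[OF that] lattice_uminus[OF is_lattice, of "v - lin g v"]
      by (simp add: t_eq_iff clinear_uminus[OF lin_clinear[OF G_Aut0[OF that]]])
    then show "inv\<^bsub>torus L\<^esub> x \<in> {x \<in> carrier (torus L). \<forall>g\<in>G. g x = x}"
      by (simp add: v(1) t_inv torus_proj_in_carrier lin_lift G_Aut0)
    fix y assume "y \<in> {x \<in> carrier (torus L). \<forall>g\<in>G. g x = x}"
    then obtain w where w: "y = t w" "\<And>g. g \<in> G \<Longrightarrow> t (lin g w) = t w"
      by (auto simp: carrier_torus lin_lift G_Aut0)
    have "t (lin g (v + w)) = t (v + w)" if "g \<in> G" for g
      unfolding clinear_add[OF lin_clinear[OF G_Aut0[OF that]]] t_mult[symmetric] v(2)[OF that] w(2)[OF that] ..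
    then show "x \<otimes>\<^bsub>torus L\<^esub> y \<in> {x \<in> carrier (torus L). \<forall>g\<in>G. g x = x}"
      by (simp add: v(1) w(1) t_mult torus_proj_in_carrier lin_lift G_Aut0)
  qed auto
  from subgroup.subgroup_is_group[OF this T.is_group] show ?thesis by (simp add: fixed_points_def)
qed

lemma translation_comp: "(\<lambda>v. v + b) \<circ> (\<lambda>v. v + a) = (\<lambda>v. v + (a + b :: complex ^ 'n))"
  by (auto simp: add.assoc)

text \<open>
  Injectivity: if translations by \<open>a\<close> and \<open>b\<close> induce the same map, they differ by an element of \<open>deck_group\<close>,
  which is a translation and hence by an element of \<open>L\<close>.
\<close>

lemma translation_map_mon: "translation_map \<in> mon TG (Aut q)"
proof -
  have "translation_map \<in> hom TG (Aut q)"
  proof (rule homI)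
    fix x assume "x \<in> carrier TG"
    then obtain a where a: "x = t a" "(\<lambda>v. v + a) \<in> flat.lifts" by (rule fixed_pointsE)
    then show "translation_map x \<in> carrier (Aut q)" by (simp add: translation_map_eq flat.descend_mem)
    fix y assume "y \<in> carrier TG"
    then obtain b where b: "y = t b" "(\<lambda>v. v + b) \<in> flat.lifts" by (rule fixed_pointsE)
    have ab: "(\<lambda>v. v + (b + a)) \<in> flat.lifts"
      using flat.lifts_comp[OF a(2) b(2)] unfolding translation_comp .
    have "x \<otimes>\<^bsub>TG\<^esub> y = t (b + a)" by (simp add: fixed_points_def a b t_mult add.commute)
    moreover have "translation_map x \<otimes>\<^bsub>Aut q\<^esub> translation_map y = flat.descend (\<lambda>v. v + (b + a))"
      by (simp only: a(1) b(1) translation_map_eq a(2) b(2) flat.descend_comp translation_comp)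
    ultimately show "translation_map (x \<otimes>\<^bsub>TG\<^esub> y) = translation_map x \<otimes>\<^bsub>Aut q\<^esub> translation_map y"
      using translation_map_eq[OF ab] by simp
  qed
  moreover have "inj_on translation_map (carrier TG)"
  proof (rule inj_onI)
    fix x y assume "x \<in> carrier TG" "y \<in> carrier TG" and eq: "translation_map x = translation_map y"
    then obtain a b where a: "x = t a" "(\<lambda>v. v + a) \<in> flat.lifts" and b: "y = t b" "(\<lambda>v. v + b) \<in> flat.lifts"
      by (metis fixed_pointsE)
    obtain \<gamma> where \<gamma>: "\<gamma> \<in> deck_group" "(\<lambda>v. v + b) = \<gamma> \<circ> (\<lambda>v. v + a)"
      using eq flat.descend_eq_iff[OF a(2) b(2)] a b translation_map_eq by auto
    have "\<gamma> w = w + (b - a)" for w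
    proof -
      have "\<gamma> w = w - a + b" using fun_cong[OF \<gamma>(2), of "w - a"] by simp
      then show ?thesis by simp
    qed
    then have "\<gamma> = (\<lambda>w. w + (b - a))" by blast
    then have "b - a \<in> L" using \<gamma>(1) translation_deck by simp
    then show "x = y" using a b t_eq_iff by simp
  qed
  ultimately show ?thesis by (simp add: mon_def)
qed

lemma linear_coset_epi: "linear_coset \<in> epi (Aut q) (S Mod G)"
proof -
  interpret normal G S by (rule normal_G)
  have mem: "linear_coset (flat.descend F) \<in> carrier (S Mod G)" if "F \<in> flat.lifts" for F
    using linear_coset_descend[OF that] linearize_S[OF that] by (auto simp: carrier_FactGroup)
  have "linear_coset \<in> hom (Aut q) (S Mod G)"
  proof (rule homI)
    fix f assume "f \<in> carrier (Aut q)"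
    then obtain F where F: "F \<in> flat.lifts" "f = flat.descend F" by (rule flat.Aut_lift)
    then show "linear_coset f \<in> carrier (S Mod G)" using mem by simp
    fix h assume "h \<in> carrier (Aut q)"
    then obtain H where H: "H \<in> flat.lifts" "h = flat.descend H" by (rule flat.Aut_lift)
    show "linear_coset (f \<otimes>\<^bsub>Aut q\<^esub> h) = linear_coset f \<otimes>\<^bsub>S Mod G\<^esub> linear_coset h"
      using F H rcos_sum[OF linearize_S[OF F(1)] linearize_S[OF H(1)]]
      by (simp add: flat.descend_comp linear_coset_descend flat.lifts_comp linearize_comp mult_S)
  qed
  moreover have "carrier (S Mod G) \<subseteq> linear_coset ` carrier (Aut q)"
  proof
    fix K assume "K \<in> carrier (S Mod G)"
    then obtain n where n: "n \<in> carrier S" "K = G #>\<^bsub>S\<^esub> n" by (auto simp: carrier_FactGroup)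
    obtain F where F: "F \<in> flat.lifts" "n = linearize F" using n(1) by (rule S_linearize)
    then show "K \<in> linear_coset ` carrier (Aut q)"
      using linear_coset_descend[OF F(1)] n(2) flat.descend_mem[OF F(1)] by auto
  qed
  ultimately show ?thesis unfolding epi_def hom_def by (auto simp: Pi_iff)
qed

text \<open>
  A map in the kernel has a lift whose linear part lies in \<open>G\<close>. Composing that lift with an element of
  \<open>deck_group\<close> removes the linear part without changing the induced map, and what remains is a translation.
\<close>

lemma exact: "translation_map ` carrier TG = kernel (Aut q) (S Mod G) linear_coset"
proof -
  interpret normal G S by (rule normal_G)
  have G_self: "G #>\<^bsub>S\<^esub> n = G \<longleftrightarrow> n \<in> G" if "n \<in> carrier S" for n
    using that coset_join1 coset_join2 subgroup_axioms is_subgroup by blast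
  show ?thesis
  proof
    show "translation_map ` carrier TG \<subseteq> kernel (Aut q) (S Mod G) linear_coset"
    proof clarify
      fix x assume "x \<in> carrier TG"
      then obtain b where b: "x = t b" "(\<lambda>v. v + b) \<in> flat.lifts" by (rule fixed_pointsE)
      have "linearize (\<lambda>v. v + b) = \<one>\<^bsub>Aut0 L\<^esub>"
        by (rule linearize_eqI) (simp_all add: b linear_part_translation lin_one id_def)
      then have "linear_coset (translation_map x) = G"
        using linear_coset_descend[OF b(2)] G_self[OF linearize_S[OF b(2)]] G_one
        by (simp add: b translation_map_eq)
      then show "translation_map x \<in> kernel (Aut q) (S Mod G) linear_coset"
        by (simp add: kernel_def b translation_map_eq flat.descend_mem)
    qed
    show "kernel (Aut q) (S Mod G) linear_coset \<subseteq> translation_map ` carrier TG"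
    proof
      fix f assume "f \<in> kernel (Aut q) (S Mod G) linear_coset"
      then have f: "f \<in> carrier (Aut q)" "linear_coset f = G" by (simp_all add: kernel_def)
      obtain F where F: "F \<in> flat.lifts" "f = flat.descend F" using f(1) by (rule flat.Aut_lift)
      have g: "linearize F \<in> G"
        using f(2) linear_coset_descend[OF F(1)] G_self[OF linearize_S[OF F(1)]] F(2) by simp
      let ?d = "deck (inv\<^bsub>Aut0 L\<^esub> linearize F) 0"
      have d: "?d \<in> deck_group" using deck_mem G_inv[OF g] lattice_zero[OF is_lattice] by blast
      let ?H = "?d \<circ> F"
      have H: "?H \<in> flat.lifts" using flat.lifts_comp flat.deck_lifts d F(1) by blast
      have "linearize ?H = \<one>\<^bsub>Aut0 L\<^esub>"
        using g G_inv F(1) lattice_zero[OF is_lattice]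
        by (simp add: linearize_comp flat.deck_lifts d linearize_deck linearize_Aut0)
      then have "linear_part ?H = id" using lin_linearize[OF H] lin_one by simp
      then have "?H v = v + ?H 0" for v using affine_eq[of ?H v] by simp
      then have H_eq: "?H = (\<lambda>v. v + ?H 0)" by blast
      then have b: "(\<lambda>v. v + ?H 0) \<in> flat.lifts" using H by simp
      have "f = flat.descend ?H" using F flat.descend_eq_iff[OF F(1) H] d by blast
      also have "\<dots> = translation_map (t (?H 0))" using translation_map_eq[OF b] H_eq by simp
      finally have "f = translation_map (t (?H 0))" .
      moreover have "t (?H 0) \<in> carrier TG"
        using b translation_lifts_iff[of "?H 0"] by (simp add: fixed_points_def torus_proj_in_carrier)
      ultimately show "f \<in> translation_map ` carrier TG" by blast
    qed
  qed
qed

text \<open>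
  The exact sequence for the class in the form \<open>cocycle_class\<close>, that is, given as the translates of \<open>z\<close> by coboundaries.
\<close>

theorem extension: "is_extension TG (Aut q) (S Mod G)"
  unfolding is_extension_def
  using group_fixed_points flat.group_Aut normal.factorgroup_is_group[OF normal_G]
    translation_map_mon linear_coset_epi exact by blast

end

section \<open>Passage from classes to cocycles\<close>

context lattice_torus
begin

lemma coboundary_eq:
  assumes "G \<subseteq> carrier (Aut0 L)"
  shows "(\<lambda>g\<in>G. g (t u) \<otimes>\<^bsub>torus L\<^esub> inv\<^bsub>torus L\<^esub> t u) = (\<lambda>g\<in>G. t (lin g u - u))"
  by (rule restrict_ext) (use assms in \<open>auto simp: lin_lift t_inv t_mult\<close>)

lemma cocycle_lift:
  assumes "z \<in> cocycles L G"
  obtains s where "\<And>g. g \<in> G \<Longrightarrow> t (s g) = z g"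
proof -
  have "\<forall>g\<in>G. z g \<in> range t" using assms by (simp add: cocycles_def carrier_torus PiE_iff)
  then have "\<forall>g\<in>G. \<exists>v. t v = z g" by (metis rangeE)
  then show ?thesis using that by metis
qed

lemma coboundary_coset_eq:
  assumes G: "G \<subseteq> carrier (Aut0 L)"
  shows "coboundaries L G #>\<^bsub>cocycle_group L G\<^esub> z = {\<lambda>g\<in>G. t (lin g u - u) \<otimes>\<^bsub>torus L\<^esub> z g | u. True}"
proof -
  have "coboundaries L G = (\<lambda>x. \<lambda>g\<in>G. g x \<otimes>\<^bsub>torus L\<^esub> inv\<^bsub>torus L\<^esub> x) ` range t"
    unfolding coboundaries_def carrier_torus by blast
  also have "\<dots> = range (\<lambda>u. \<lambda>g\<in>G. t (lin g u - u))"
    unfolding image_image coboundary_eq[OF G] ..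
  finally have "coboundaries L G #>\<^bsub>cocycle_group L G\<^esub> z =
      range (\<lambda>u. \<lambda>g\<in>G. (\<lambda>g\<in>G. t (lin g u - u)) g \<otimes>\<^bsub>torus L\<^esub> z g)"
    by (auto simp: r_coset_def cocycle_group_def)
  also have "\<dots> = range (\<lambda>u. \<lambda>g\<in>G. t (lin g u - u) \<otimes>\<^bsub>torus L\<^esub> z g)"
    by (intro arg_cong[where f = range] ext restrict_ext) simp
  finally show ?thesis by auto
qed

lemma cohomologous_cocycle:
  assumes G: "subgroup G (Aut0 L)" and z0: "z0 \<in> cocycles L G"
  shows "(\<lambda>g\<in>G. t (lin g u - u) \<otimes>\<^bsub>torus L\<^esub> z0 g) \<in> cocycles L G" (is "?z \<in> _")
proof -
  have G': "g \<in> carrier (Aut0 L)" if "g \<in> G" for g using subgroup.mem_carrier[OF G that] .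
  obtain s0 where s0: "\<And>g. g \<in> G \<Longrightarrow> z0 g = t (s0 g)" using cocycle_lift[OF z0] by metis
  have z: "?z g = t (lin g u - u + s0 g)" if "g \<in> G" for g using that by (simp add: s0 t_mult)
  have "?z (g \<otimes>\<^bsub>Aut0 L\<^esub> h) = ?z g \<otimes>\<^bsub>torus L\<^esub> g (?z h)" if gh: "g \<in> G" "h \<in> G" for g h
  proof -
    have mem: "g \<otimes>\<^bsub>Aut0 L\<^esub> h \<in> G" using subgroup.m_closed[OF G gh] .
    have "z0 (g \<otimes>\<^bsub>Aut0 L\<^esub> h) = z0 g \<otimes>\<^bsub>torus L\<^esub> g (z0 h)" using z0 gh by (simp add: cocycles_def)
    then have eq: "t (s0 (g \<otimes>\<^bsub>Aut0 L\<^esub> h)) = t (s0 g + lin g (s0 h))"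
      by (simp add: s0 gh mem lin_lift G' t_mult)
    have "?z (g \<otimes>\<^bsub>Aut0 L\<^esub> h) = t (lin g (lin h u) - u) \<otimes>\<^bsub>torus L\<^esub> t (s0 (g \<otimes>\<^bsub>Aut0 L\<^esub> h))"
      unfolding z[OF mem] t_mult by (simp add: lin_mult G' gh)
    also have "\<dots> = t (lin g (lin h u) - u + (s0 g + lin g (s0 h)))" unfolding eq t_mult ..
    also have "\<dots> = t (lin g u - u + s0 g + lin g (lin h u - u + s0 h))"
      using clinear_add[OF lin_clinear[OF G'[OF gh(1)]]] clinear_diff[OF lin_clinear[OF G'[OF gh(1)]]]
      by (simp add: algebra_simps)
    also have "\<dots> = ?z g \<otimes>\<^bsub>torus L\<^esub> g (?z h)"
      unfolding z[OF gh(1)] z[OF gh(2)] lin_lift[OF G'[OF gh(1)]] t_mult ..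
    finally show ?thesis .
  qed
  moreover have "?z \<in> G \<rightarrow>\<^sub>E carrier (torus L)"
    using z torus_proj_in_carrier by (auto simp: PiE_def extensional_def)
  ultimately show ?thesis unfolding cocycles_def by blast
qed

end

theorem theorem4p2:
  fixes L :: "(complex ^ 'n) set"
    and G :: "'n torus_map set"
    and \<alpha> :: "('n torus_map \<Rightarrow> (complex ^ 'n) set) set"
    and z :: "'n torus_map \<Rightarrow> (complex ^ 'n) set"
  assumes "is_lattice L"
    and "subgroup G (Aut0 L)" and "finite G"
    and "\<alpha> \<in> carrier (H1 L G)" and "special L G \<alpha>"
    and "z \<in> \<alpha>"
  shows "is_extension (fixed_points L G) (Aut (flat_proj L G z)) (class_stabilizer L G \<alpha> Mod G)"
proof -
  interpret lattice_torus L using assms(1) by unfold_locales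
  have G: "G \<subseteq> carrier (Aut0 L)" using subgroup.subset[OF assms(2)] .
  obtain z0 where z0: "z0 \<in> cocycles L G" "\<alpha> = coboundaries L G #>\<^bsub>cocycle_group L G\<^esub> z0"
    using assms(4) by (auto simp: H1_def carrier_FactGroup cocycle_group_def)
  have \<alpha>: "\<alpha> = {\<lambda>g\<in>G. t (lin g u - u) \<otimes>\<^bsub>torus L\<^esub> z0 g | u. True}"
    unfolding z0(2) by (rule coboundary_coset_eq[OF G])
  obtain u0 where u0: "z = (\<lambda>g\<in>G. t (lin g u0 - u0) \<otimes>\<^bsub>torus L\<^esub> z0 g)" using assms(6) \<alpha> by blast
  have z: "z \<in> cocycles L G" unfolding u0 by (rule cohomologous_cocycle[OF assms(2) z0(1)])
  obtain s where s: "\<And>g. g \<in> G \<Longrightarrow> t (s g) = z g" using cocycle_lift[OF z] by metis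
  have torsion_free: "torsion_free (extension_group L G (connecting L s))"
    using assms(5,6) s unfolding special_def by blast
  interpret special_cocycle L G z s
  proof (intro special_cocycle.intro special_cocycle_axioms.intro)
    show "lattice_torus L" by (rule lattice_torus_axioms)
    show "t (s g) = z g" if "g \<in> G" for g using s that .
  qed (rule assms(2) assms(3) z torsion_free)+
  obtain s0 where s0: "\<And>g. g \<in> G \<Longrightarrow> z0 g = t (s0 g)" using cocycle_lift[OF z0(1)] by metis
  \<comment> \<open>The class is given as a coset of \<open>z0\<close>, whereas \<open>cocycle_class\<close> is based at \<open>z\<close>.\<close>
  have eq: "(\<lambda>g\<in>G. t (lin g u - u) \<otimes>\<^bsub>torus L\<^esub> z0 g) = translate_cocycle (u - u0)" for u
    unfolding translate_cocycle_def
  proof (rule restrict_ext)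
    fix g assume g: "g \<in> G"
    have "t (s g) = t (lin g u0 - u0 + s0 g)" using s[OF g] g by (simp add: u0 s0 t_mult)
    then have "t (s g) \<otimes>\<^bsub>torus L\<^esub> t (lin g (u - u0) - (u - u0))
        = t (lin g u0 - u0 + s0 g) \<otimes>\<^bsub>torus L\<^esub> t (lin g (u - u0) - (u - u0))" by simp
    then show "t (lin g u - u) \<otimes>\<^bsub>torus L\<^esub> z0 g = t (s g + (lin g (u - u0) - (u - u0)))"
      by (simp add: s0[OF g] t_mult clinear_diff[OF lin_clinear[OF G_Aut0[OF g]]] algebra_simps)
  qed
  have "\<alpha> = range (\<lambda>u. translate_cocycle (u - u0))" unfolding \<alpha> eq by auto
  also have "\<dots> = cocycle_class"
    unfolding cocycle_class_def
  proof
    show "range translate_cocycle \<subseteq> range (\<lambda>u. translate_cocycle (u - u0))"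
    proof clarify
      fix u
      show "translate_cocycle u \<in> range (\<lambda>u. translate_cocycle (u - u0))"
        by (rule range_eqI[of _ _ "u + u0"]) simp
    qed
  qed blast
  finally show ?thesis using extension by simp
qed

end
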